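(* Let $F$ be a field of characteristic $0$. Denote by $I$ the irreducible left $M_2(F)$-module isomorphic to the minimal left ideal $\langle e_{12}, e_{22}\rangle_F \subset M_2(F)$ ($e_{ij}$ are the matrix units). Let $A = M_2(F)\oplus I$ (direct sum of left ideals), where $M_2(F)$ acts on $I$ from the left by the module structure, $I\,M_2(F) := 0$ and $I^2:=0$. Let $T_3=\lbrace e_1,e_2\rbrace$ be the right zero band of two elements. Define a $T_3$-grading on $A$ by $A^{(e_1)}=(M_2(F),0)$, $A^{(e_2)}=\lbrace (\varphi(a), a) \mid a \in I \rbrace$, where $\varphi \colon I \hookrightarrow M_2(F)$ is the natural embedding (with image $\langle e_{12}, e_{22}\rangle_F$), which is a homomorphism of left $M_2(F)$-modules. Then the limit $\lim_{n\to \infty} \sqrt[n]{c_n^{T_3\text{-}\mathrm{gr}}(A)}$ exists and equals $3+2\sqrt 2= 5.8284\ldots$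
   Context: A right zero band is a semigroup $T$ with $t_1t_2=t_2$ for all $t_1,t_2\in T$. For a semigroup $T$, an algebra $A$ is $T$-graded if $A=\bigoplus_{t\in T}A^{(t)}$ (direct sum of subspaces) with $A^{(h)}A^{(t)}\subseteq A^{(ht)}$ for all $h,t\in T$. Graded codimensions: let $F\langle X^{T\text{-}\mathrm{gr}}\rangle$ be the free associative algebra (non-commutative polynomials) on the variables $x^{(t)}_i$, $t\in T$, $i\in\mathbb N$. A polynomial $f(x^{(t_1)}_{i_1},\dots,x^{(t_s)}_{i_s})$ is a graded polynomial identity of the $T$-graded algebra $A$ if it vanishes whenever each $x^{(t_j)}_{i_j}$ is replaced by an arbitrary element of $A^{(t_j)}$; the set of all of them is the ideal $\mathrm{Id}^{T\text{-}\mathrm{gr}}(A)$. Let $P^{T\text{-}\mathrm{gr}}_n$ be the $F$-linear span of all monomials $x^{(t_1)}_{\sigma(1)}x^{(t_2)}_{\sigma(2)}\cdots x^{(t_n)}_{\sigma(n)}$ with $t_i\in T$, $\sigma\in S_n$. The $n$th graded codimension is $c^{T\text{-}\mathrm{gr}}_n(A)=\dim_F\bigl(P^{T\text{-}\mathrm{gr}}_n/(P^{T\text{-}\mathrm{gr}}_n\cap \mathrm{Id}^{T\text{-}\mathrm{gr}}(A))\bigr)$. *)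

theory Defs
  imports
    "HOL-Analysis.Analysis"
    "HOL-Library.Poly_Mapping"
    "HOL-Library.Set_Algebras"
    "HOL-Combinatorics.Permutations"
begin

definition quotient_space :: "'v::ab_group_add set \<Rightarrow> 'v set \<Rightarrow> 'v set set" where
  "quotient_space U W = (\<lambda>u. u +o W) ` U"

text \<open>Sums of sets are taken elementwise. The summand \<open>W\<close> makes the value a coset also when all
  coefficients vanish or \<open>B\<close> is empty; it then is the zero \<open>W\<close> of the quotient.\<close>

definition coset_lincomb ::
    "('a::field \<Rightarrow> 'v::ab_group_add \<Rightarrow> 'v) \<Rightarrow> 'v set \<Rightarrow> ('v set \<Rightarrow> 'a) \<Rightarrow> 'v set set \<Rightarrow> 'v set" where
  "coset_lincomb sc W c B = W + (\<Sum>X\<in>B. sc (c X) ` X)"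

definition quotient_basis ::
    "('a::field \<Rightarrow> 'v::ab_group_add \<Rightarrow> 'v) \<Rightarrow> 'v set \<Rightarrow> 'v set \<Rightarrow> 'v set set \<Rightarrow> bool" where
  "quotient_basis sc U W B \<longleftrightarrow>
     finite B \<and> B \<subseteq> quotient_space U W \<and>
     (\<forall>c. coset_lincomb sc W c B = W \<longrightarrow> (\<forall>X\<in>B. c X = 0)) \<and>
     (\<forall>Y\<in>quotient_space U W. \<exists>c. Y = coset_lincomb sc W c B)"

text \<open>As for the library's \<^const>\<open>vector_space.dim\<close>, the value is \<open>0\<close> in the
  infinite-dimensional case.\<close>

definition quotient_dim ::
    "('a::field \<Rightarrow> 'v::ab_group_add \<Rightarrow> 'v) \<Rightarrow> 'v set \<Rightarrow> 'v set \<Rightarrow> nat" where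
  "quotient_dim sc U W =
     (if \<exists>B. quotient_basis sc U W B then card (SOME B. quotient_basis sc U W B) else 0)"

locale assoc_algebra = vector_space scale
  for scale :: "'a::field \<Rightarrow> 'v::ab_group_add \<Rightarrow> 'v" +
  fixes mul :: "'v \<Rightarrow> 'v \<Rightarrow> 'v"
  assumes mult_assoc: "mul (mul x y) z = mul x (mul y z)"
    and mult_add_left: "mul (x + y) z = mul x z + mul y z"
    and mult_add_right: "mul x (y + z) = mul x y + mul x z"
    and mult_scale_left: "mul (scale c x) y = scale c (mul x y)"
    and mult_scale_right: "mul x (scale c y) = scale c (mul x y)"

locale graded_algebra = assoc_algebra scale mul
  for scale :: "'a::field \<Rightarrow> 'v::ab_group_add \<Rightarrow> 'v" and mul :: "'v \<Rightarrow> 'v \<Rightarrow> 'v" +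
  fixes component :: "'t::semigroup_mult \<Rightarrow> 'v set"
  assumes component_subspace: "subspace (component t)"
    and direct_sum:
      "\<exists>!f. (\<forall>t. f t \<in> component t) \<and> finite {t. f t \<noteq> 0} \<and> v = (\<Sum>t | f t \<noteq> 0. f t)"
    and component_mult: "x \<in> component h \<Longrightarrow> y \<in> component t \<Longrightarrow> mul x y \<in> component (h * t)"

text \<open>Words form a free monoid, written additively because \<^typ>\<open>'x \<Rightarrow>\<^sub>0 'a\<close> is the monoid algebra of an
  additively written monoid; its multiplication on words is concatenation. The variable \<open>x\<^sup>(\<^sup>t\<^sup>)\<^sub>i\<close> is
  encoded by the letter \<open>(t, i)\<close>.\<close>

datatype 'x word = Word (letters: "'x list")

instantiation word :: (type) monoid_add
begin

definition zero_word :: "'a word" where "0 = Word []"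

definition plus_word :: "'a word \<Rightarrow> 'a word \<Rightarrow> 'a word" where
  "v + w = Word (letters v @ letters w)"

instance
  by standard (simp_all add: zero_word_def plus_word_def)

end

type_synonym ('t, 'a) gr_poly = "('t \<times> nat) word \<Rightarrow>\<^sub>0 'a"

definition gr_var :: "'t \<Rightarrow> nat \<Rightarrow> ('t, 'a::field) gr_poly" where
  "gr_var t i = Poly_Mapping.single (Word [(t, i)]) 1"

definition gr_scale :: "'a::field \<Rightarrow> ('t, 'a) gr_poly \<Rightarrow> ('t, 'a) gr_poly" where
  "gr_scale c f = Poly_Mapping.map ((*) c) f"

lemma lookup_gr_scale: "Poly_Mapping.lookup (gr_scale c f) w = c * Poly_Mapping.lookup f w"
  by (simp add: gr_scale_def Poly_Mapping.map.rep_eq when_def)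

global_interpretation gr: vector_space gr_scale
  by standard
    (auto simp: lookup_gr_scale lookup_add algebra_simps intro!: poly_mapping_eqI)

text \<open>The free algebra is taken without unit: polynomials have no constant term.\<close>

definition free_algebra :: "('t, 'a::field) gr_poly set" where
  "free_algebra = {f. Poly_Mapping.lookup f 0 = 0}"

text \<open>The product of the empty list is a junk value: no unit is assumed.\<close>

fun list_product :: "('v \<Rightarrow> 'v \<Rightarrow> 'v) \<Rightarrow> 'v::zero list \<Rightarrow> 'v" where
  "list_product mul [] = 0"
| "list_product mul [x] = x"
| "list_product mul (x # y # zs) = mul x (list_product mul (y # zs))"

definition poly_value ::
    "('a::field \<Rightarrow> 'v::ab_group_add \<Rightarrow> 'v) \<Rightarrow> ('v \<Rightarrow> 'v \<Rightarrow> 'v) \<Rightarrow> ('t \<times> nat \<Rightarrow> 'v) \<Rightarrow>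
     ('t, 'a) gr_poly \<Rightarrow> 'v" where
  "poly_value sc mul a f =
     (\<Sum>w\<in>Poly_Mapping.keys f.
        sc (Poly_Mapping.lookup f w) (list_product mul (map a (letters w))))"

definition graded_identities ::
    "('a::field \<Rightarrow> 'v::ab_group_add \<Rightarrow> 'v) \<Rightarrow> ('v \<Rightarrow> 'v \<Rightarrow> 'v) \<Rightarrow> ('t \<Rightarrow> 'v set) \<Rightarrow>
     ('t, 'a) gr_poly set" where
  "graded_identities sc mul component =
     {f \<in> free_algebra.
        \<forall>a. (\<forall>t i. a (t, i) \<in> component t) \<longrightarrow> poly_value sc mul a f = 0}"

definition multilinear_polys :: "nat \<Rightarrow> ('t, 'a::field) gr_poly set" where
  "multilinear_polys n =
     gr.span {prod_list (map (\<lambda>k. gr_var (t k) (\<sigma> k)) [1..<Suc n]) | t \<sigma>. \<sigma> permutes {1..n}}"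

definition graded_codim ::
    "('a::field \<Rightarrow> 'v::ab_group_add \<Rightarrow> 'v) \<Rightarrow> ('v \<Rightarrow> 'v \<Rightarrow> 'v) \<Rightarrow> ('t \<Rightarrow> 'v set) \<Rightarrow> nat \<Rightarrow> nat" where
  "graded_codim sc mul component n =
     quotient_dim gr_scale (multilinear_polys n)
       (multilinear_polys n \<inter> graded_identities sc mul component)"

class right_zero_band = semigroup_mult +
  assumes right_zero: "s * t = t"

datatype T3 = E1 | E2

instantiation T3 :: right_zero_band
begin

definition times_T3 :: "T3 \<Rightarrow> T3 \<Rightarrow> T3" where "(s :: T3) * t = t"

instance
  by standard (simp_all add: times_T3_def)

end

text \<open>The module \<open>I\<close> is realised as the column vectors \<^typ>\<open>'a^2\<close> with the action \<open>m *v x\<close>; that it is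
  irreducible and isomorphic, through \<open>\<phi>\<close> below, to the left ideal spanned by the matrix units
  \<open>e\<^sub>1\<^sub>2\<close> and \<open>e\<^sub>2\<^sub>2\<close> is proved below.\<close>

type_synonym 'a M2 = "'a^2^2"
type_synonym 'a I_mod = "'a^2"
type_synonym 'a A_alg = "'a M2 \<times> 'a I_mod"

definition mat_scale :: "'a::field \<Rightarrow> 'a M2 \<Rightarrow> 'a M2" where
  "mat_scale c m = (\<chi> i j. c * m $ i $ j)"

definition mat_unit :: "2 \<Rightarrow> 2 \<Rightarrow> 'a::field M2" where
  "mat_unit k l = (\<chi> i j. if i = k \<and> j = l then 1 else 0)"

definition \<phi> :: "'a::field I_mod \<Rightarrow> 'a M2" where
  "\<phi> x = mat_scale (x $ 1) (mat_unit 1 2) + mat_scale (x $ 2) (mat_unit 2 2)"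

definition A_scale :: "'a::field \<Rightarrow> 'a A_alg \<Rightarrow> 'a A_alg" where
  "A_scale c p = (mat_scale c (fst p), c *s snd p)"

definition A_mult :: "'a::field A_alg \<Rightarrow> 'a A_alg \<Rightarrow> 'a A_alg" where
  "A_mult p q = (fst p ** fst q, fst p *v snd q)"

fun A_component :: "T3 \<Rightarrow> 'a::field A_alg set" where
  "A_component E1 = {(m, 0) | m. True}"
| "A_component E2 = {(\<phi> x, x) | x. True}"

global_interpretation mat: vector_space mat_scale
  by standard (simp_all add: mat_scale_def vec_eq_iff algebra_simps)

lemma phi_nth: "\<phi> x $ i $ j = (if j = 2 then x $ i else 0)"
  using exhaust_2[of i] exhaust_2[of j] by (auto simp: \<phi>_def mat_scale_def mat_unit_def)

lemma phi_module_hom: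
  "\<phi> (x + y) = \<phi> x + \<phi> y" "\<phi> (c *s x) = mat_scale c (\<phi> x)" "\<phi> (m *v x) = m ** \<phi> x"
  by (auto simp: vec_eq_iff phi_nth mat_scale_def matrix_vector_mult_def matrix_matrix_mult_def)

lemma inj_phi: "inj \<phi>"
proof (rule injI)
  fix x y :: "'a I_mod"
  assume "\<phi> x = \<phi> y"
  then have "\<phi> x $ i $ 2 = \<phi> y $ i $ 2" for i by simp
  then show "x = y" by (simp add: vec_eq_iff phi_nth)
qed

lemma range_phi: "range (\<phi> :: 'a::field I_mod \<Rightarrow> 'a M2) = mat.span {mat_unit 1 2, mat_unit 2 2}"
proof
  show "range (\<phi> :: 'a I_mod \<Rightarrow> 'a M2) \<subseteq> mat.span {mat_unit 1 2, mat_unit 2 2}"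
    by (auto simp: \<phi>_def intro!: mat.span_add mat.span_scale intro: mat.span_base)
  show "mat.span {mat_unit 1 2, mat_unit 2 2} \<subseteq> range (\<phi> :: 'a I_mod \<Rightarrow> 'a M2)"
  proof (rule mat.span_minimal)
    have "mat_unit k 2 = \<phi> (axis k (1 :: 'a))" for k
      by (auto simp: vec_eq_iff phi_nth mat_unit_def axis_def)
    then show "{mat_unit 1 2, mat_unit 2 2} \<subseteq> range (\<phi> :: 'a I_mod \<Rightarrow> 'a M2)"
      by simp
    show "mat.subspace (range (\<phi> :: 'a I_mod \<Rightarrow> 'a M2))"
    proof (rule mat.subspaceI)
      have "\<phi> (0 :: 'a I_mod) = 0" by (simp add: vec_eq_iff phi_nth)
      then show "0 \<in> range (\<phi> :: 'a I_mod \<Rightarrow> 'a M2)" by (rule range_eqI[OF sym])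
    next
      fix y z
      assume "y \<in> range (\<phi> :: 'a I_mod \<Rightarrow> 'a M2)" "z \<in> range (\<phi> :: 'a I_mod \<Rightarrow> 'a M2)"
      then show "y + z \<in> range (\<phi> :: 'a I_mod \<Rightarrow> 'a M2)"
        by (auto simp flip: phi_module_hom(1))
    next
      fix c and y
      assume "y \<in> range (\<phi> :: 'a I_mod \<Rightarrow> 'a M2)"
      then show "mat_scale c y \<in> range (\<phi> :: 'a I_mod \<Rightarrow> 'a M2)"
        by (auto simp flip: phi_module_hom(2))
    qed
  qed
qed

lemma I_mod_irreducible:
  fixes N :: "'a::field I_mod set"
  assumes "0 \<in> N" "\<And>x y. x \<in> N \<Longrightarrow> y \<in> N \<Longrightarrow> x + y \<in> N" "\<And>m x. x \<in> N \<Longrightarrow> m *v x \<in> N"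
  shows "N = {0} \<or> N = UNIV"
proof (cases "N = {0}")
  case False
  then obtain x k where x: "x \<in> N" "x $ k \<noteq> 0"
    using assms(1) by (metis (no_types, opaque_lifting) all_not_in_conv insertI1 singletonD subsetI
        subset_singletonD vec_eq_iff zero_index)
  have "y \<in> N" for y
  proof -
    define m :: "'a M2" where "m = (\<chi> i j. if j = k then y $ i / x $ k else 0)"
    have "m *v x = y"
      using x(2) exhaust_2[of k]
      by (auto simp: m_def matrix_vector_mult_def vec_eq_iff sum_2)
    then show ?thesis using assms(3)[OF x(1), of m] by simp
  qed
  then show ?thesis by auto
qed simp

lemma UNIV_T3: "UNIV = {E1, E2}"
  using T3.exhaust by auto

lemma A_graded_algebra: "graded_algebra A_scale A_mult (A_component :: T3 \<Rightarrow> 'a::field A_alg set)"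
proof
  show "A_mult (A_mult x y) z = A_mult x (A_mult y z)" for x y z :: "'a A_alg"
    by (simp add: A_mult_def matrix_mul_assoc matrix_vector_mul_assoc)
  show "A_mult x y \<in> A_component (h * t)"
    if "x \<in> A_component h" "y \<in> A_component t" for x y :: "'a A_alg" and h t
    using that by (cases h; cases t) (auto simp: A_mult_def times_T3_def phi_module_hom)
  show "module.subspace A_scale (A_component t :: 'a A_alg set)" for t
  proof -
    interpret A: vector_space "A_scale :: 'a \<Rightarrow> _"
      by standard (simp_all add: A_scale_def mat_scale_def vec_eq_iff algebra_simps)
    have "\<phi> 0 = (0 :: 'a M2)" by (simp add: vec_eq_iff phi_nth)
    then show ?thesis
      by (cases t) (auto simp: A.subspace_def A_scale_def phi_module_hom zero_prod_def)
  qed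
  show "\<exists>!f. (\<forall>t. f t \<in> A_component t) \<and> finite {t. f t \<noteq> 0} \<and> v = (\<Sum>t | f t \<noteq> 0. f t)"
    for v :: "'a A_alg"
  proof -
    have fin: "finite S" for S :: "T3 set"
      using UNIV_T3 by (metis finite.emptyI finite.insertI finite_subset subset_UNIV)
    have sum: "(\<Sum>t | f t \<noteq> 0. f t) = f E1 + f E2" for f :: "T3 \<Rightarrow> 'a A_alg"
    proof -
      have "(\<Sum>t | f t \<noteq> 0. f t) = (\<Sum>t\<in>UNIV. f t)"
        by (rule sum.mono_neutral_left) (auto simp: fin)
      then show ?thesis by (simp add: UNIV_T3)
    qed
    show ?thesis unfolding sum
    proof (rule ex1I[of _ "\<lambda>t. case t of E1 \<Rightarrow> (fst v - \<phi> (snd v), 0) | E2 \<Rightarrow> (\<phi> (snd v), snd v)"],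
        goal_cases)
      case 1
      show ?case by (auto simp: fin split: T3.split)
    next
      case (2 f)
      then have "f E1 \<in> A_component E1" "f E2 \<in> A_component E2" and v: "v = f E1 + f E2"
        by blast+
      then obtain m x where f: "f E1 = (m, 0)" "f E2 = (\<phi> x, x)" by auto
      show ?case
      proof
        show "f t = (case t of E1 \<Rightarrow> (fst v - \<phi> (snd v), 0) | E2 \<Rightarrow> (\<phi> (snd v), snd v))" for t
          by (cases t) (simp_all add: v f)
      qed
    qed
  qed
qed (simp_all add: A_mult_def A_scale_def mat_scale_def vec_eq_iff algebra_simps
    matrix_matrix_mult_def matrix_vector_mult_def sum.distrib sum_distrib_left)

end

theory Submission
  imports Defs "HOL-Library.Function_Algebras" "HOL-Real_Asymp.Real_Asymp"
begin

text \<open>A multilinear polynomial is determined modulo the identities by its values at basis elements: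
  four matrix units for a variable of degree \<open>E1\<close>, and \<open>(e\<^sub>1\<^sub>2, e\<^sub>1)\<close>, \<open>(e\<^sub>2\<^sub>2, e\<^sub>2)\<close>
    for one of degree \<open>E2\<close>.
  Give \<open>e\<^sub>1\<^sub>2\<close> weight 1 and \<open>e\<^sub>2\<^sub>1\<close> weight -1. A value can be nonzero only if the total weight is
    at most 1, and
  the number of such assignments is at most \<open>t\<^sup>-\<^sup>1 (3 + 2t + 1/t)\<^sup>n\<close>
    for \<open>0 < t \<le> 1\<close>; take \<open>t = 1/\<surd>2\<close>.

  For the lower bound, a monomial detects whether the set \<open>R\<close> of variables with column index 1 is
    mapped by
  the successor map \<open>\<tau>\<close> of the word onto the set \<open>C\<close> of variables with row index 1. Match each
    element of \<open>C\<close>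
  with a smaller element outside \<open>C\<close>, and each variable of degree \<open>E1\<close> outside \<open>R\<close> with a smaller
    one in \<open>R\<close>,
  choose \<open>\<tau>\<close> compatible with the two matchings,
    and antisymmetrise over the pairs at \<open>C\<close>: the resulting
  polynomials have a triangular evaluation matrix. To keep \<open>\<tau>\<close> free of cycles, cut the variables
    into
  consecutive segments of length \<open>l\<close> and let \<open>\<tau>\<close> map each segment to the next one. Up to
    polynomial factors,
  matchable sets are as numerous as all sets (ballot numbers), so a segment contributes the
    largest of
  the terms \<open>(l choose p)\<^sup>2 2\<^sup>l\<^sup>-\<^sup>p\<close>, which are the squares of the terms of \<open>(1 + \<surd>2)\<^sup>l\<close>, and
  \<open>(1 + \<surd>2)\<^sup>2 = 3 + 2\<surd>2\<close>.\<close>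

subsection \<open>Dimension of a quotient\<close>

text \<open>Adding \<open>W\<close> absorbs the choice of the representatives \<open>r\<close>. This
  includes zero coefficients, where the scaled coset shrinks to zero and the extra summand
  \<open>W\<close> restores a full coset.\<close>

lemma coset_lincomb_eq:
  assumes "vector_space sc" and W: "module.subspace sc W"
    and "finite B" and "\<And>X. X \<in> B \<Longrightarrow> X = r X +o W"
  shows "coset_lincomb sc W c B = (\<Sum>X\<in>B. sc (c X) (r X)) +o W"
proof -
  interpret vector_space sc by fact
  have add: "a +o W + (sc k ` (b +o W)) = (sc k b + a) +o W" for a b k
  proof -
    have "w + sc k w' \<in> W" if "w \<in> W" "w' \<in> W" for w w'
      using that W by (simp add: subspace_add subspace_scale)
    moreover have "0 \<in> W" using W by (rule subspace_0)
    ultimately show ?thesis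
      by (force simp: elt_set_plus_def set_plus_def image_iff scale_right_distrib algebra_simps
            intro!: exI[of _ "_ :: 'b"])
  qed
  show ?thesis using assms(3,4)
  proof (induction B)
    case empty
    then show ?case
      by (auto simp: coset_lincomb_def elt_set_plus_def set_plus_def set_zero)
  next
    case (insert X B)
    have "coset_lincomb sc W c (insert X B) = coset_lincomb sc W c B + sc (c X) ` X"
      using insert.hyps by (simp add: coset_lincomb_def ac_simps)
    also have "\<dots> = (\<Sum>X\<in>B. sc (c X) (r X)) +o W + sc (c X) ` (r X +o W)"
      using insert by simp
    also have "\<dots> = (\<Sum>X\<in>insert X B. sc (c X) (r X)) +o W"
      using insert.hyps by (simp add: add)
    finally show ?case .
  qed
qed

context vector_space
begin

text \<open>Links the coefficient condition of \<open>quotient_basis\<close>, stated for a family,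
  with the library's \<open>independent\<close>, stated for sets. The difference is repetition: two
  equal members give a relation with coefficients 1 and -1.\<close>

lemma independent_family_iff:
  fixes v :: "'c \<Rightarrow> 'b"
  assumes "finite B"
  shows "(\<forall>c. (\<Sum>x\<in>B. scale (c x) (v x)) = 0 \<longrightarrow> (\<forall>x\<in>B. c x = 0)) \<longleftrightarrow>
    inj_on v B \<and> independent (v ` B)"
proof (intro iffI conjI)
  assume c: "\<forall>c. (\<Sum>x\<in>B. scale (c x) (v x)) = 0 \<longrightarrow> (\<forall>x\<in>B. c x = 0)"
  show inj: "inj_on v B"
  proof (rule inj_onI, rule ccontr)
    fix x y assume xy: "x \<in> B" "y \<in> B" "v x = v y" "x \<noteq> y"
    define c :: "'c \<Rightarrow> 'a" where "c z = (if z = x then 1 else if z = y then -1 else 0)" for z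
    have "(\<Sum>z\<in>B. scale (c z) (v z)) = (\<Sum>z\<in>{x,y}. scale (c z) (v z))"
      using xy assms by (intro sum.mono_neutral_right) (auto simp: c_def)
    also have "\<dots> = 0" using xy by (simp add: c_def)
    finally have "c x = 0" using c xy by blast
    then show False by (simp add: c_def)
  qed
  show "independent (v ` B)"
  proof (rule independent_if_scalars_zero)
    fix f x assume f: "(\<Sum>x\<in>v ` B. scale (f x) x) = 0" and x: "x \<in> v ` B"
    have "(\<Sum>x\<in>B. scale (f (v x)) (v x)) = 0" using f by (simp add: sum.reindex[OF inj])
    then show "f x = 0" using c[rule_format, of "f \<circ> v"] x by auto
  qed (use assms in simp)
next
  assume *: "inj_on v B \<and> independent (v ` B)"
  show "\<forall>c. (\<Sum>x\<in>B. scale (c x) (v x)) = 0 \<longrightarrow> (\<forall>x\<in>B. c x = 0)"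
  proof (intro allI impI ballI)
    fix c x assume c: "(\<Sum>x\<in>B. scale (c x) (v x)) = 0" and x: "x \<in> B"
    have "(\<Sum>y\<in>v ` B. scale (c (inv_into B v y)) y) = 0"
      using c * by (simp add: sum.reindex cong: sum.cong)
    then have "c (inv_into B v (v x)) = 0"
      using independentD[of "v ` B" "v ` B" "\<lambda>y. c (inv_into B v y)" "v x"] * assms x by auto
    then show "c x = 0" using * x by simp
  qed
qed

lemma span_image_finite:
  assumes "finite B"
  shows "x \<in> span (v ` B) \<longleftrightarrow> (\<exists>c. x = (\<Sum>b\<in>B. scale (c b) (v b)))"
proof
  assume "x \<in> span (v ` B)"
  then show "\<exists>c. x = (\<Sum>b\<in>B. scale (c b) (v b))"
  proof (induction rule: span_induct_alt)
    case base
    show ?case by (rule exI[of _ "\<lambda>_. 0"]) simp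
  next
    case (step k y z)
    then obtain a c where a: "a \<in> B" "y = v a" and c: "z = (\<Sum>b\<in>B. scale (c b) (v b))" by blast
    have "scale k y + z = (\<Sum>b\<in>B. scale ((if b = a then k else 0) + c b) (v b))"
      using a assms by (simp add: scale_left_distrib sum.distrib c if_distrib[of "\<lambda>k. scale k _"]
          sum.delta cong: if_cong)
    then show ?case by (rule exI[of _ "\<lambda>b. (if b = a then k else 0) + c b"])
  qed
qed (auto intro!: span_sum span_scale intro: span_base)

end

text \<open>First isomorphism theorem: cosets correspond to values of \<open>T\<close>, so a set of
  cosets is a basis exactly when \<open>T\<close> sends its representatives to a basis of the image.
  The finite spanning set \<open>G\<close> guarantees a finite basis, so that
  \<open>quotient_dim\<close> does not take its default value 0.\<close>

lemma quotient_dim_eq_dim_image: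
  fixes U :: "'b::ab_group_add set" and T :: "'b \<Rightarrow> 'c::ab_group_add"
  assumes T: "Vector_Spaces.linear s1 s2 T" and U: "module.subspace s1 U"
    and fin: "finite G" "T ` U \<subseteq> module.span s2 G"
  shows "quotient_dim s1 U (U \<inter> {f. T f = 0}) = vector_space.dim s2 (T ` U)"
proof -
  interpret T: Vector_Spaces.linear s1 s2 T by fact
  define W where "W = U \<inter> {f. T f = 0}"
  have W: "T.vs1.subspace W"
    unfolding W_def using U
    by (auto intro!: T.vs1.subspaceI simp: T.vs1.subspace_0 T.vs1.subspace_add
      T.vs1.subspace_scale T.add T.scale)
  have coset_eq: "u +o W = v +o W \<longleftrightarrow> T u = T v" if "u \<in> U" "v \<in> U" for u v
  proof
    assume "u +o W = v +o W"
    moreover have "u \<in> u +o W"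
      using T.vs1.subspace_0[OF W] by (force simp: elt_set_plus_def)
    ultimately obtain w where "w \<in> W" "u = v + w" by (auto simp: elt_set_plus_def)
    then show "T u = T v" by (auto simp: W_def T.add)
  next
    assume eq: "T u = T v"
    have sub: "x +o W \<subseteq> y +o W" if "x \<in> U" "y \<in> U" "T x = T y" for x y
    proof
      fix z assume "z \<in> x +o W"
      then obtain w where w: "w \<in> W" "z = x + w" by (auto simp: elt_set_plus_def)
      then have "(x - y) + w \<in> W" using that U
        by (auto simp: W_def T.add T.diff T.vs1.subspace_add T.vs1.subspace_diff)
      moreover have "z = y + ((x - y) + w)" using w by simp
      ultimately show "z \<in> y +o W" unfolding elt_set_plus_def by blast
    qed
    show "u +o W = v +o W" using sub that eq by (simp add: subset_antisym)
  qed
  have lincomb: "coset_lincomb s1 W c B = (\<Sum>X\<in>B. s1 (c X) (r X)) +o W"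
      "(\<Sum>X\<in>B. s1 (c X) (r X)) \<in> U" "T (\<Sum>X\<in>B. s1 (c X) (r X)) = (\<Sum>X\<in>B. s2 (c X) (T (r X)))"
    if "finite B" "\<And>X. X \<in> B \<Longrightarrow> r X \<in> U \<and> X = r X +o W" for B r c
    using that coset_lincomb_eq[OF T.vs1.vector_space_axioms W, of B r c]
    by (auto simp: T.sum T.scale intro!: T.vs1.subspace_sum U T.vs1.subspace_scale)
  have zeroW: "W = 0 +o W" by (auto simp: elt_set_plus_def)
  have 0: "0 \<in> U" using U by (rule T.vs1.subspace_0)
  have *: "quotient_basis s1 U W B \<longleftrightarrow> inj_on (T \<circ> r) B \<and> T.vs2.independent ((T \<circ> r) ` B) \<and>
            T ` U \<subseteq> T.vs2.span ((T \<circ> r) ` B)"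
    if B: "finite B" "\<And>X. X \<in> B \<Longrightarrow> r X \<in> U \<and> X = r X +o W" for B r
  proof -
    have "B \<subseteq> quotient_space U W" using B by (auto simp: quotient_space_def)
    moreover have "coset_lincomb s1 W c B = W \<longleftrightarrow> (\<Sum>X\<in>B. s2 (c X) (T (r X))) = 0" for c
      using coset_eq[OF lincomb(2)[OF B] 0] lincomb[OF B] zeroW by (simp add: T.zero)
    moreover have "(\<forall>Y\<in>quotient_space U W. \<exists>c. Y = coset_lincomb s1 W c B) \<longleftrightarrow>
        (\<forall>u\<in>U. \<exists>c. T u = (\<Sum>X\<in>B. s2 (c X) (T (r X))))"
      using coset_eq[OF _ lincomb(2)[OF B]] lincomb[OF B] by (simp add: quotient_space_def)
    ultimately have qb: "quotient_basis s1 U W B \<longleftrightarrow>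
        (\<forall>c. (\<Sum>X\<in>B. s2 (c X) (T (r X))) = 0 \<longrightarrow> (\<forall>X\<in>B. c X = 0)) \<and>
        (\<forall>u\<in>U. \<exists>c. T u = (\<Sum>X\<in>B. s2 (c X) (T (r X))))"
      using B(1) by (simp add: quotient_basis_def)
    show ?thesis unfolding qb conj_assoc[symmetric] T.vs2.independent_family_iff[OF B(1), symmetric]
      image_subset_iff T.vs2.span_image_finite[OF B(1)] o_def ..
  qed
  \<comment> \<open>All quotient bases have the same size, which makes the choice by
    \<open>SOME\<close> harmless.\<close>
  have card: "card B = T.vs2.dim (T ` U)" if B: "quotient_basis s1 U W B" for B
  proof -
    have "\<forall>X\<in>B. \<exists>u\<in>U. X = u +o W" using B by (auto simp: quotient_basis_def quotient_space_def)
    then obtain r where r: "\<And>X. X \<in> B \<Longrightarrow> r X \<in> U \<and> X = r X +o W" by metis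
    have "finite B" using B by (simp add: quotient_basis_def)
    note * = *[OF this r, THEN iffD1, OF _ B]
    have "T.vs2.span ((T \<circ> r) ` B) = T.vs2.span (T ` U)"
      using * r by (intro T.vs2.span_eq[THEN iffD2]) (auto intro: T.vs2.span_base)
    then have "T.vs2.dim (T ` U) = card ((T \<circ> r) ` B)"
      using * by (intro T.vs2.dim_eq_card) auto
    then show ?thesis using * by (metis card_image)
  qed
  \<comment> \<open>Existence: a basis of the image is lifted to cosets through chosen preimages
    \<open>u\<close>.\<close>
  obtain V where V: "V \<subseteq> T ` U" "T.vs2.independent V" "T ` U \<subseteq> T.vs2.span V"
    by (rule T.vs2.maximal_independent_subset)
  have "finite V" using V fin by (meson T.vs2.independent_span_bound order_trans)
  have "\<forall>x\<in>V. \<exists>u. u \<in> U \<and> T u = x" using V(1) by (fast dest: subsetD)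
  then obtain u where u: "\<And>x. x \<in> V \<Longrightarrow> u x \<in> U \<and> T (u x) = x" by (metis (full_types))
  define B where "B = (\<lambda>x. u x +o W) ` V"
  have inj: "inj_on (\<lambda>x. u x +o W) V"
  proof (rule inj_onI)
    fix x y assume xy: "x \<in> V" "y \<in> V" "u x +o W = u y +o W"
    then have "T (u x) = T (u y)" using coset_eq u by blast
    then show "x = y" using u xy by simp
  qed
  define r where "r X = u (inv_into V (\<lambda>x. u x +o W) X)" for X
  have r: "r (u x +o W) = u x" if "x \<in> V" for x unfolding r_def inv_into_f_f[OF inj that] ..
  have T_r: "(T \<circ> r) (u x +o W) = x" if "x \<in> V" for x using r u that by simp
  have "(T \<circ> r) ` B = V" unfolding B_def image_image using T_r by simp
  moreover have "inj_on (T \<circ> r) B" unfolding B_def by (rule inj_onI) (use T_r in force)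
  moreover have "r X \<in> U \<and> X = r X +o W" if "X \<in> B" for X
    using that u r by (auto simp: B_def)
  moreover have "finite B" using \<open>finite V\<close> by (simp add: B_def)
  ultimately have "quotient_basis s1 U W B"
    using V by (intro *[of B r, THEN iffD2]) blast+
  then have "quotient_basis s1 U W (SOME B. quotient_basis s1 U W B)" by (rule someI)
  then show ?thesis
    unfolding quotient_dim_def W_def[symmetric] using card by (metis (full_types))
qed

subsection \<open>Words in matrix units\<close>

text \<open>The letter \<open>(t, i, j)\<close> stands for the basis element of degree \<open>t\<close> whose matrix part is
  \<open>e\<^sub>i\<^sub>j\<close>, where
  \<^term>\<open>True\<close> is the index 1 and \<^term>\<open>False\<close> the index 2. In degree \<open>E2\<close> only \<open>j = False\<close> is allowed.\<close>

type_synonym letter = "T3 \<times> bool \<times> bool"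

definition deg_of :: "letter \<Rightarrow> T3" where "deg_of l = fst l"
definition row_ix :: "letter \<Rightarrow> bool" where "row_ix l = fst (snd l)"
definition col_ix :: "letter \<Rightarrow> bool" where "col_ix l = snd (snd l)"

definition Letters :: "letter set" where
  "Letters = {(E1, True, True), (E1, True, False), (E1, False, True), (E1, False, False),
     (E2, True, False), (E2, False, False)}"

definition idx :: "bool \<Rightarrow> 2" where "idx b = (if b then 1 else 2)"

definition basis_elem :: "letter \<Rightarrow> 'a::field A_alg" where
  "basis_elem l = (mat_unit (idx (row_ix l)) (idx (col_ix l)),
     if deg_of l = E1 then 0 else axis (idx (row_ix l)) 1)"

text \<open>A walk on the two indices: the word starts at row index \<open>s\<close>, each column
  index is the next row index, and the last column index is \<open>e\<close>. Row and column indices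
  are parameters because the predicate serves both for letters and for variables with assigned
  letters.\<close>

fun compat :: "('x \<Rightarrow> bool) \<Rightarrow> ('x \<Rightarrow> bool) \<Rightarrow> bool \<Rightarrow> 'x list \<Rightarrow> bool \<Rightarrow> bool" where
  "compat c r s [] e \<longleftrightarrow> s = e"
| "compat c r s (x # xs) e \<longleftrightarrow> c x = s \<and> compat c r (r x) xs e"

lemma compat_append: "compat c r s (xs @ ys) e \<longleftrightarrow> (\<exists>u. compat c r s xs u \<and> compat c r u ys e)"
  by (induction xs arbitrary: s) auto

lemma compat_cong:
  "(\<And>x. x \<in> set xs \<Longrightarrow> c x = c' x) \<Longrightarrow> (\<And>x. x \<in> set xs \<Longrightarrow> r x = r' x) \<Longrightarrow>
    compat c r s xs e \<longleftrightarrow> compat c' r' s xs e"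
  by (induction xs arbitrary: s) auto

lemma idx_eq [simp]: "idx a = idx b \<longleftrightarrow> a = b" by (auto simp: idx_def)

lemma sum_idx: "(\<Sum>k\<in>UNIV. f k) = (\<Sum>b\<in>UNIV. f (idx b))" for f :: "2 \<Rightarrow> 'a::comm_monoid_add"
  by (simp add: UNIV_bool sum_2 idx_def add.commute)

lemma sum_bool: "(\<Sum>b\<in>UNIV. f b) = f True + f False" for f :: "bool \<Rightarrow> 'a::comm_monoid_add"
  by (simp add: UNIV_bool add.commute)

text \<open>Matrix parts multiply as ordinary matrices in both degrees, so a product of matrix units
  is a matrix unit if the indices chain up and 0 otherwise.\<close>

lemma fst_list_product:
  assumes "xs \<noteq> []"
  shows "fst (list_product A_mult (map (basis_elem :: letter \<Rightarrow> 'a::field A_alg) xs)) $ idx s $ idx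
    e =
     of_bool (compat row_ix col_ix s xs e)"
  using assms
proof (induction xs arbitrary: s rule: list_nonempty_induct)
  case (single x)
  then show ?case by (auto simp: basis_elem_def mat_unit_def)
next
  case (cons x xs)
  then obtain y ys where xs: "xs = y # ys" by (cases xs) auto
  have "fst (list_product A_mult (map basis_elem (x # xs))) $ idx s $ idx e =
    (\<Sum>b\<in>UNIV. (mat_unit (idx (row_ix x)) (idx (col_ix x)) :: 'a M2) $ idx s $ idx b *
        fst (list_product A_mult (map basis_elem xs)) $ idx b $ idx e)"
    by (simp add: xs A_mult_def matrix_matrix_mult_def sum_idx basis_elem_def)
  also have "\<dots> = of_bool (compat row_ix col_ix s (x # xs) e)"
    unfolding cons.IH sum_bool by (cases "col_ix x") (auto simp: mat_unit_def)
  finally show ?case .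
qed

text \<open>A word evaluated at matrix units has (2,2)-entry 1 if consecutive letters are composable,
  and 0
  otherwise. The inequality \<open>i < \<tau> i\<close> excludes cycles, which would be traces and not monomials: the
  chains of \<open>\<tau>\<close> all end outside \<open>S\<close>, where the row index is 2, and can be concatenated.\<close>

lemma exists_path_word:
  assumes "finite V" "S \<subseteq> V" "inj_on \<tau> S" "\<And>i. i \<in> S \<Longrightarrow> \<tau> i \<in> V \<and> (i::nat) < \<tau> i"
  shows "\<exists>w. distinct w \<and> set w = V \<and> (\<forall>c r. (\<forall>i\<in>V - S. \<not> r i) \<longrightarrow>
    (compat c r False w False \<longleftrightarrow> (\<forall>i\<in>S. r i = c (\<tau> i)) \<and> (\<forall>j\<in>V - \<tau> ` S. \<not> c j)))"
  using assms
proof (induction V arbitrary: S rule: finite_linorder_min_induct)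
  case empty
  then show ?case by simp
next
  case (insert i V)
  define S' where "S' = S - {i}"
  have S': "S' \<subseteq> V" "inj_on \<tau> S'" using insert.prems by (auto simp: S'_def inj_on_def)
  have \<tau>V: "\<tau> j \<in> V" if "j \<in> S" for j using insert.prems(3)[OF that] insert.prems(1)
    insert.hyps(2) that
    by (metis insert_iff order.asym subsetD)
  have "\<And>j. j \<in> S' \<Longrightarrow> \<tau> j \<in> V \<and> j < \<tau> j" using insert.prems \<tau>V by (auto simp: S'_def)
  from insert.IH[OF S' this] obtain w where w: "distinct w" "set w = V"
    and wc: "\<And>c r. (\<forall>j\<in>V - S'. \<not> r j) \<Longrightarrow> compat c r False w False \<longleftrightarrow>
       (\<forall>j\<in>S'. r j = c (\<tau> j)) \<and> (\<forall>j\<in>V - \<tau> ` S'. \<not> c j)" by blast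
  have iV: "i \<notin> V" using insert.hyps by blast
  show ?case
  proof (cases "i \<in> S")
    case False
    \<comment> \<open>Outside \<open>S\<close> the column index is 2, which is the start required by
      \<open>w\<close>; so \<open>i\<close> can be put in front.\<close>
    then have [simp]: "S' = S" by (auto simp: S'_def)
    have "i \<notin> \<tau> ` S" using \<tau>V iV by auto
    then have "compat c r False (i # w) False \<longleftrightarrow>
        (\<forall>j\<in>S. r j = c (\<tau> j)) \<and> (\<forall>j\<in>insert i V - \<tau> ` S. \<not> c j)"
      if "\<forall>j\<in>insert i V - S. \<not> r j" for c r
      using that False wc[of r c] by (auto simp: insert_Diff_if)
    then show ?thesis using w iV by (intro exI[of _ "i # w"]) auto
  next
    case True
    define y where "y = \<tau> i"
    have y: "y \<in> V" "y \<notin> \<tau> ` S'" "S = insert i S'" "i \<notin> S'"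
      using \<tau>V[OF True] insert.prems(2) True by (auto simp: y_def S'_def inj_on_def)
    then obtain a b where ab: "w = a @ y # b" using w split_list by metis
    have "compat c r False (a @ i # y # b) False \<longleftrightarrow>
        (\<forall>j\<in>S. r j = c (\<tau> j)) \<and> (\<forall>j\<in>insert i V - \<tau> ` S. \<not> c j)"
      if r: "\<forall>j\<in>insert i V - S. \<not> r j" for c r
    proof -
      \<comment> \<open>Here \<open>i\<close> stands just before \<open>y = \<tau> i\<close>. If
        \<open>r i = c y\<close>, the two act as one letter with the row index of \<open>i\<close>
        and the column index of \<open>y\<close>, so the induction hypothesis is used with the row
        index of \<open>y\<close> replaced.\<close>
      let ?c = "c(y := c i)"
      have c: "compat ?c r s xs e \<longleftrightarrow> compat c r s xs e" if "y \<notin> set xs" for s xs e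
        using that by (intro compat_cong) auto
      have "y \<notin> set a" "y \<notin> set b" using w ab by auto
      then have "compat c r False (a @ i # y # b) False \<longleftrightarrow> r i = c y \<and> compat ?c r False w False"
        unfolding ab by (auto simp: compat_append c)
      also have "compat ?c r False w False \<longleftrightarrow>
         (\<forall>j\<in>S'. r j = ?c (\<tau> j)) \<and> (\<forall>j\<in>V - \<tau> ` S'. \<not> ?c j)"
        using r y iV by (intro wc) auto
      also have "(\<forall>j\<in>S'. r j = ?c (\<tau> j)) \<longleftrightarrow> (\<forall>j\<in>S'. r j = c (\<tau> j))"
        using y by (intro ball_cong refl) auto
      also have "(\<forall>j\<in>V - \<tau> ` S'. \<not> ?c j) \<longleftrightarrow> (\<forall>j\<in>insert i V - \<tau> ` S. \<not> c j)"
      proof -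
        have "insert i V - \<tau> ` S = insert i (V - \<tau> ` S' - {y})"
          using y iV \<tau>V by (auto simp: y_def[symmetric])
        moreover have "V - \<tau> ` S' = insert y (V - \<tau> ` S' - {y})" using y by auto
        moreover have "(\<forall>j\<in>insert y X. \<not> ?c j) \<longleftrightarrow> (\<forall>j\<in>insert i X. \<not> c j)" if "y \<notin> X" for X
          using that by auto
        ultimately show ?thesis by (metis DiffD2 insertI1)
      qed
      finally show ?thesis by (auto simp: y y_def[symmetric])
    qed
    then show ?thesis using w ab iV y by (intro exI[of _ "a @ i # y # b"]) auto
  qed
qed

subsection \<open>Evaluation of polynomials\<close>

context vector_space
begin

lemma poly_value_superset:
  assumes "finite K" "Poly_Mapping.keys f \<subseteq> K"
  shows "poly_value scale mul a f =
    (\<Sum>w\<in>K. scale (Poly_Mapping.lookup f w) (list_product mul (map a (letters w))))"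
  unfolding poly_value_def using assms
  by (intro sum.mono_neutral_left) (auto simp: in_keys_iff)

lemma poly_value_add: "poly_value scale mul a (f + g) = poly_value scale mul a f +
  poly_value scale mul a g"
proof -
  let ?K = "Poly_Mapping.keys f \<union> Poly_Mapping.keys g"
  show ?thesis
    using Poly_Mapping.keys_add[of f g]
    by (simp add: poly_value_superset[of ?K] lookup_add scale_left_distrib sum.distrib)
qed

lemma poly_value_gr_scale: "poly_value scale mul a (gr_scale c f) = scale c
  (poly_value scale mul a f)"
proof -
  have "Poly_Mapping.keys (gr_scale c f) \<subseteq> Poly_Mapping.keys f"
    by (auto simp: in_keys_iff lookup_gr_scale)
  then show ?thesis
    by (simp add: poly_value_superset[of "Poly_Mapping.keys f"] lookup_gr_scale scale_sum_right)
qed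

lemma poly_value_single: "poly_value scale mul a (Poly_Mapping.single w 1) = list_product mul
  (map a (letters w))"
  by (simp add: poly_value_def)

lemma linear_poly_value: "Vector_Spaces.linear gr_scale scale (poly_value scale mul a)"
  by unfold_locales (simp_all add: poly_value_add poly_value_gr_scale)

end

definition monomial :: "('x \<Rightarrow> 't) \<Rightarrow> 'x list \<Rightarrow> ('t \<times> 'x) word \<Rightarrow>\<^sub>0 'a::field" where
  "monomial s w = Poly_Mapping.single (Word (map (\<lambda>i. (s i, i)) w)) 1"

lemma prod_list_gr_var:
  "prod_list (map (\<lambda>k. gr_var (t k) (\<sigma> k)) ks) =
    Poly_Mapping.single (Word (map (\<lambda>k. (t k, \<sigma> k)) ks)) (1::'a::field)"
proof (induction ks)
  case Nil
  then show ?case by (simp flip: single_one zero_word_def)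
next
  case (Cons k ks)
  then show ?case by (simp add: gr_var_def mult_single plus_word_def)
qed

text \<open>In the definition degrees belong to positions; here they belong to variables, and a word
  without repetitions replaces the permutation.\<close>

lemma multilinear_polys_eq:
  "(multilinear_polys n :: ('t, 'a::field) gr_poly set) =
    gr.span {monomial s w | s w. distinct w \<and> set w = {1..n}}"
proof -
  have "{prod_list (map (\<lambda>k. gr_var (t k) (\<sigma> k)) [1..<Suc n]) | t \<sigma>. \<sigma> permutes {1..n}} =
     {monomial s w :: ('t, 'a) gr_poly | s w. distinct w \<and> set w = {1..n}}" (is "?A = ?B")
  proof (intro equalityI subsetI)
    fix f assume "f \<in> ?A"
    then obtain t \<sigma> where \<sigma>: "\<sigma> permutes {1..n}"
      and f: "f = prod_list (map (\<lambda>k. gr_var (t k) (\<sigma> k)) [1..<Suc n])" by blast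
    have "f = monomial (t \<circ> inv \<sigma>) (map \<sigma> [1..<Suc n])"
      by (simp add: f prod_list_gr_var monomial_def permutes_inverses[OF \<sigma>] o_def del: upt_Suc)
    moreover have "distinct (map \<sigma> [1..<Suc n])"
      using permutes_inj[OF \<sigma>] by (auto simp: distinct_map inj_on_def simp del: upt_Suc)
    moreover have "set (map \<sigma> [1..<Suc n]) = {1..n}"
      using permutes_image[OF \<sigma>] by (simp add: atLeastLessThanSuc_atLeastAtMost del: upt_Suc)
    ultimately show "f \<in> ?B" by blast
  next
    fix f assume "f \<in> ?B"
    then obtain s w where w: "distinct w" "set w = {1..n}" and f: "f = monomial s w" by blast
    then have len: "length w = n" using distinct_card by fastforce
    define \<sigma> where "\<sigma> k = (if k \<in> {1..n} then w ! (k - 1) else k)" for k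
    have map: "map \<sigma> [1..<Suc n] = w"
      by (rule nth_equalityI) (auto simp: len \<sigma>_def simp del: upt_Suc)
    have "\<sigma> permutes {1..n}"
    proof (rule bij_imp_permutes)
      have "\<sigma> ` {1..n} = {1..n}" using arg_cong[OF map, of set] w(2)
        by (simp add: atLeastLessThanSuc_atLeastAtMost del: upt_Suc)
      then show "bij_betw \<sigma> {1..n} {1..n}"
        by (simp add: bij_betw_def eq_card_imp_inj_on)
    qed (auto simp: \<sigma>_def)
    moreover have "f = prod_list (map (\<lambda>k. gr_var ((s \<circ> \<sigma>) k) (\<sigma> k)) [1..<Suc n])"
      unfolding prod_list_gr_var f monomial_def map[symmetric] by (simp add: o_def del: upt_Suc)
    ultimately show "f \<in> ?A" by blast
  qed
  then show ?thesis by (simp only: multilinear_polys_def)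
qed

section \<open>Substituting basis elements for the variables\<close>

interpretation A: assoc_algebra A_scale A_mult
  using A_graded_algebra unfolding graded_algebra_def by blast

text \<open>A variable whose degree differs from that of its letter gets 0. Thus each
  \<open>letter_val \<beta>\<close> is an admissible graded substitution, and monomials whose
  degrees disagree with \<open>\<beta>\<close> vanish.\<close>

definition letter_val :: "(nat \<Rightarrow> letter) \<Rightarrow> T3 \<times> nat \<Rightarrow> 'a::field A_alg" where
  "letter_val \<beta> x = (if \<beta> (snd x) \<in> Letters \<and> deg_of (\<beta> (snd x)) = fst x then basis_elem (\<beta>
    (snd x)) else 0)"

lemma finite_Letters [simp]: "finite Letters" by (simp add: Letters_def)

lemma A_mult_sum: "A_mult (sum f S) (sum g S') = (\<Sum>(x, y)\<in>S \<times> S'. A_mult (f x) (g y))"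
proof -
  have left: "A_mult (sum f S) y = (\<Sum>x\<in>S. A_mult (f x) y)" for y
    by (induction S rule: infinite_finite_induct)
      (simp_all add: A.mult_add_left, simp_all add: A_mult_def zero_prod_def)
  have right: "A_mult y (sum g S') = (\<Sum>x\<in>S'. A_mult y (g x))" for y
    by (induction S' rule: infinite_finite_induct)
      (simp_all add: A.mult_add_right, simp_all add: A_mult_def zero_prod_def)
  show ?thesis unfolding left unfolding right by (simp add: sum.cartesian_product)
qed

lemma list_product_Cons: "xs \<noteq> [] \<Longrightarrow> list_product mul (x # xs) = mul x (list_product mul xs)"
  by (cases xs) auto

text \<open>Distributivity. As \<open>xs\<close> is distinct, choosing one summand in each factor
  amounts to choosing a function on \<open>set xs\<close>.\<close>

lemma list_product_expand:
  assumes "xs \<noteq> []" "distinct xs" "finite L"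
  shows "list_product A_mult (map (\<lambda>x. \<Sum>l\<in>L. A_scale (k x l) (e x l)) xs) =
    (\<Sum>\<beta>\<in>PiE (set xs) (\<lambda>_. L). A_scale (\<Prod>x\<in>set xs. k x (\<beta> x)) (list_product A_mult (map (\<lambda>x. e x
      (\<beta> x)) xs)))"
  using assms(1,2)
proof (induction xs rule: list_nonempty_induct)
  case (single x)
  have "(\<Sum>\<beta>\<in>PiE {x} (\<lambda>_. L). A_scale (k x (\<beta> x)) (e x (\<beta> x))) = (\<Sum>l\<in>L. A_scale (k x l) (e x l))"
    by (rule sum.reindex_bij_witness[of _ "\<lambda>l y. if y = x then l else undefined" "\<lambda>\<beta>. \<beta> x"])
      (auto simp: PiE_def extensional_def fun_eq_iff)
  then show ?case by simp
next
  case (cons x xs)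
  let ?P = "PiE (set xs) (\<lambda>_. L)"
  have x: "x \<notin> set xs" and d: "distinct xs" using cons by auto
  have "list_product A_mult (map (\<lambda>x. \<Sum>l\<in>L. A_scale (k x l) (e x l)) (x # xs)) =
    A_mult (\<Sum>l\<in>L. A_scale (k x l) (e x l))
     (\<Sum>\<beta>\<in>?P. A_scale (\<Prod>x\<in>set xs. k x (\<beta> x)) (list_product A_mult (map (\<lambda>x. e x (\<beta> x)) xs)))"
    using cons by (simp add: list_product_Cons)
  also have "\<dots> = (\<Sum>(l, \<beta>)\<in>L \<times> ?P. A_scale (k x l * (\<Prod>x\<in>set xs. k x (\<beta> x)))
      (A_mult (e x l) (list_product A_mult (map (\<lambda>x. e x (\<beta> x)) xs))))"
    by (simp add: A_mult_sum A.mult_scale_left A.mult_scale_right mult.commute)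
  also have "\<dots> = (\<Sum>(l, \<beta>)\<in>L \<times> ?P. A_scale (\<Prod>y\<in>set (x # xs). k y ((\<beta>(x := l)) y))
      (list_product A_mult (map (\<lambda>y. e y ((\<beta>(x := l)) y)) (x # xs))))"
  proof (intro sum.cong refl, safe)
    fix l \<beta>
    have "(\<Prod>y\<in>set xs. k y ((\<beta>(x := l)) y)) = (\<Prod>y\<in>set xs. k y (\<beta> y))"
      using x by (intro prod.cong) auto
    then have p: "(\<Prod>y\<in>set (x # xs). k y ((\<beta>(x := l)) y)) = k x l * (\<Prod>y\<in>set xs. k y (\<beta> y))"
      using x by simp
    have m: "map (\<lambda>y. e y ((\<beta>(x := l)) y)) (x # xs) = e x l # map (\<lambda>y. e y (\<beta> y)) xs"
      using x by auto
    show "A_scale (k x l * (\<Prod>x\<in>set xs. k x (\<beta> x)))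
      (A_mult (e x l) (list_product A_mult (map (\<lambda>x. e x (\<beta> x)) xs))) =
      A_scale (\<Prod>y\<in>set (x # xs). k y ((\<beta>(x := l)) y))
      (list_product A_mult (map (\<lambda>y. e y ((\<beta>(x := l)) y)) (x # xs)))"
      unfolding p m using cons.hyps by (simp add: list_product_Cons)
  qed
  also have "\<dots> = (\<Sum>\<beta>\<in>PiE (set (x # xs)) (\<lambda>_. L). A_scale (\<Prod>y\<in>set (x # xs). k y (\<beta> y))
      (list_product A_mult (map (\<lambda>y. e y (\<beta> y)) (x # xs))))"
    unfolding list.set PiE_insert_eq using x
    by (subst sum.reindex) (auto simp: case_prod_unfold intro!: inj_onI simp: fun_eq_iff PiE_def
      extensional_def, metis+)
  finally show ?case .
qed

text \<open>The basis elements of degree \<open>t\<close> span the component; letters of the other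
  degree contribute 0, so that both degrees share one index set \<open>Letters\<close>.\<close>

lemma mem_component_iff:
  "x \<in> A_component t \<longleftrightarrow> (\<exists>c. x = (\<Sum>l\<in>Letters. A_scale (c l)
    (if deg_of l = t then basis_elem l else 0)))"
    (is "?L \<longleftrightarrow> ?R") for x :: "'a::field A_alg"
proof
  assume x: ?L
  show ?R
  proof (cases t)
    case E1
    define c where "c l = fst x $ idx (row_ix l) $ idx (col_ix l)" for l
    have "snd x = 0" using x E1 by auto
    then show ?thesis using E1
      by (intro exI[of _ c])
        (auto simp: Letters_def c_def deg_of_def row_ix_def col_ix_def basis_elem_def A_scale_def
          mat_scale_def
          mat_unit_def vec_eq_iff idx_def prod_eq_iff forall_2 zero_prod_def)
  next
    case E2
    then obtain v where v: "x = (\<phi> v, v)" using x by auto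
    define c where "c l = v $ idx (row_ix l)" for l
    show ?thesis using E2
      by (intro exI[of _ c])
        (auto simp: v Letters_def c_def deg_of_def row_ix_def col_ix_def basis_elem_def
          A_scale_def mat_scale_def
          mat_unit_def vec_eq_iff idx_def prod_eq_iff forall_2 zero_prod_def phi_nth axis_def)
  qed
next
  interpret G: graded_algebra A_scale A_mult "A_component :: T3 \<Rightarrow> 'a A_alg set"
    by (rule A_graded_algebra)
  have "A_component E1 = {y :: 'a A_alg. snd y = 0}"
    "A_component E2 = {y :: 'a A_alg. fst y = \<phi> (snd y)}"
    by (auto simp: prod_eq_iff)
  then have "(if deg_of l = t then basis_elem l else 0) \<in> (A_component t :: 'a A_alg set)"
    if "l \<in> Letters" for l
    using that
    by (cases t) (auto simp: Letters_def deg_of_def row_ix_def col_ix_def basis_elem_def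
      vec_eq_iff forall_2
        phi_nth axis_def idx_def mat_unit_def simp del: A_component.simps)
  moreover assume ?R
  ultimately show ?L
    using G.component_subspace[of t] by (auto intro!: A.subspace_sum A.subspace_scale)
qed

lemma letter_val_component: "letter_val \<beta> (t, i) \<in> A_component t"
  unfolding mem_component_iff
  by (rule exI[of _ "\<lambda>l. of_bool (l = \<beta> i)"])
    (simp add: letter_val_def of_bool_def if_distrib[of "\<lambda>c. A_scale c _"] sum.delta cong: if_cong)

definition letter_maps :: "nat \<Rightarrow> (nat \<Rightarrow> letter) set" where
  "letter_maps n = PiE {1..n} (\<lambda>_. Letters)"

lemma finite_letter_maps [simp]: "finite (letter_maps n)"
  by (simp add: letter_maps_def finite_PiE)

text \<open>Multilinearity reduces arbitrary graded substitutions to the finitely many letter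
  substitutions.\<close>

lemma poly_value_expand:
  fixes a :: "T3 \<times> nat \<Rightarrow> 'a::field A_alg"
  assumes n: "n \<ge> 1" and a: "\<And>t i. a (t, i) \<in> A_component t"
  shows "\<exists>K. \<forall>f\<in>multilinear_polys n. poly_value A_scale A_mult a f =
    (\<Sum>\<beta>\<in>letter_maps n. A_scale (K \<beta>) (poly_value A_scale A_mult (letter_val \<beta>) f))"
proof -
  have "\<forall>t i. \<exists>c. a (t, i) = (\<Sum>l\<in>Letters. A_scale (c l) (if deg_of l = t then basis_elem l else 0))"
    using a unfolding mem_component_iff by blast
  then obtain c where c: "\<And>t i. a (t, i) = (\<Sum>l\<in>Letters. A_scale (c t i l)
    (if deg_of l = t then basis_elem l else 0))"
    unfolding choice_iff by blast
  \<comment> \<open>A letter has only one degree, so one coefficient per variable index and letter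
    serves both degrees.\<close>
  define k where "k i l = c (deg_of l) i l" for i l
  have k: "a (t, i) = (\<Sum>l\<in>Letters. A_scale (k i l) (if deg_of l = t then basis_elem l else 0))"
    for t i
    unfolding c k_def by (intro sum.cong) auto
  let ?K = "\<lambda>\<beta>. \<Prod>i\<in>{1..n}. k i (\<beta> i)"
  interpret L: Vector_Spaces.linear gr_scale A_scale "poly_value A_scale A_mult h"
    for h :: "T3 \<times> nat \<Rightarrow> 'a A_alg"
    by (rule A.linear_poly_value)
  have "poly_value A_scale A_mult a f =
    (\<Sum>\<beta>\<in>letter_maps n. A_scale (?K \<beta>) (poly_value A_scale A_mult (letter_val \<beta>) f))"
    if "f \<in> multilinear_polys n" for f
    using that unfolding multilinear_polys_eq
  proof (induction rule: gr.span_induct_alt)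
    case base
    then show ?case by (simp add: L.zero)
  next
    case (step b f g)
    then obtain s w where w: "distinct w" "set w = {1..n}" and f: "f = monomial s w" by blast
    have "w \<noteq> []" using w n by auto
    let ?e = "\<lambda>i l. if deg_of l = s i then basis_elem l else 0"
    have val: "poly_value A_scale A_mult h f = list_product A_mult (map (\<lambda>i. h (s i, i)) w)"
      for h :: "T3 \<times> nat \<Rightarrow> 'a A_alg"
      by (simp add: f monomial_def A.poly_value_single o_def)
    have map_k: "map (\<lambda>i. a (s i, i)) w = map (\<lambda>i. \<Sum>l\<in>Letters. A_scale (k i l) (?e i l)) w"
      by (intro map_cong refl k)
    have "poly_value A_scale A_mult a f =
        (\<Sum>\<beta>\<in>letter_maps n. A_scale (?K \<beta>) (list_product A_mult (map (\<lambda>i. ?e i (\<beta> i)) w)))"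
      unfolding val map_k letter_maps_def w(2)[symmetric]
      by (rule list_product_expand) (use w \<open>w \<noteq> []\<close> in auto)
    also have "\<dots> = (\<Sum>\<beta>\<in>letter_maps n. A_scale (?K \<beta>) (poly_value A_scale A_mult (letter_val \<beta>) f))"
    proof (intro sum.cong refl)
      fix \<beta> assume "\<beta> \<in> letter_maps n"
      then have m: "map (\<lambda>i. ?e i (\<beta> i)) w = map (\<lambda>i. letter_val \<beta> (s i, i) :: 'a A_alg) w"
        using w by (auto simp: letter_val_def letter_maps_def)
      show "A_scale (?K \<beta>) (list_product A_mult (map (\<lambda>i. ?e i (\<beta> i)) w)) =
          A_scale (?K \<beta>) (poly_value A_scale A_mult (letter_val \<beta>) f)"
        unfolding val m by (rule refl)
    qed
    finally have "poly_value A_scale A_mult a f =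
        (\<Sum>\<beta>\<in>letter_maps n. A_scale (?K \<beta>) (poly_value A_scale A_mult (letter_val \<beta>) f))" .
    then show ?case
      by (simp add: L.add L.scale step.IH A.scale_sum_right A.scale_left_commute
        A.scale_right_distrib sum.distrib mult.commute)
  qed
  then show ?thesis by (intro exI[of _ ?K] ballI)
qed

section \<open>The evaluation map and its rank\<close>

definition coord :: "'a::field A_alg \<Rightarrow> 2 \<times> 2 + 2 \<Rightarrow> 'a" where
  "coord p k = (case k of Inl (i, j) \<Rightarrow> fst p $ i $ j | Inr i \<Rightarrow> snd p $ i)"

lemma coord_eq_0: "(\<forall>k. coord p k = 0) \<longleftrightarrow> p = 0"
  by (auto simp: coord_def prod_eq_iff vec_eq_iff split: sum.splits)

lemma linear_coord: "coord (p + q) k = coord p k + coord q k"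
  "coord (A_scale c p) k = c * coord p k"
  by (auto simp: coord_def A_scale_def mat_scale_def split: sum.splits)

text \<open>All coordinates of all letter substitutions at once. The value 0 outside the finite set
  \<open>letter_maps n\<close> keeps the image finite-dimensional.\<close>

definition eval_map :: "nat \<Rightarrow> (T3, 'a::field) gr_poly \<Rightarrow> (nat \<Rightarrow> letter) \<times> (2 \<times> 2 + 2) \<Rightarrow> 'a" where
  "eval_map n f x = (if fst x \<in> letter_maps n
     then coord (poly_value A_scale A_mult (letter_val (fst x)) f) (snd x) else 0)"

definition fun_scale :: "'a::field \<Rightarrow> ('x \<Rightarrow> 'a) \<Rightarrow> 'x \<Rightarrow> 'a" where "fun_scale c v x = c * v x"

interpretation fn: vector_space fun_scale
  by standard (simp_all add: fun_scale_def fun_eq_iff algebra_simps)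

lemma linear_eval_map: "Vector_Spaces.linear gr_scale fun_scale (eval_map n)"
  by unfold_locales (simp_all add: eval_map_def fun_scale_def fun_eq_iff A.poly_value_add
    A.poly_value_gr_scale linear_coord)

text \<open>Letter substitutions are graded, and by \<open>poly_value_expand\<close> they determine
  all others. For \<open>n \<ge> 1\<close> every monomial is a nonempty word, so there is no
  constant term.\<close>

lemma multilinear_Int_identities:
  assumes n: "n \<ge> 1"
  shows "multilinear_polys n \<inter> graded_identities A_scale A_mult
    (A_component :: T3 \<Rightarrow> 'a::field A_alg set) =
    multilinear_polys n \<inter> {f. eval_map n f = 0}"
proof (intro set_eqI iffI; elim IntE; intro IntI)
  fix f :: "(T3, 'a) gr_poly"
  assume f: "f \<in> multilinear_polys n"
  { assume id: "f \<in> graded_identities A_scale A_mult A_component"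
    have "eval_map n f x = 0" for x
    proof -
      have "poly_value A_scale A_mult (letter_val (fst x)) f = 0"
        using id by (auto simp: graded_identities_def letter_val_component)
      then show ?thesis using coord_eq_0[of "0 :: 'a A_alg"] by (simp add: eval_map_def)
    qed
    then show "f \<in> {f. eval_map n f = 0}" by (simp add: fun_eq_iff) }
  { assume f0: "f \<in> {f. eval_map n f = 0}"
    have "f \<in> free_algebra"
      using f unfolding multilinear_polys_eq
    proof (induction rule: gr.span_induct_alt)
      case (step b f g)
      then obtain s w where w: "set w = {1..n}" and f: "f = monomial s w" by blast
      have "w \<noteq> []" using w n by auto
      then have "Poly_Mapping.lookup f 0 = 0"
        by (simp add: f monomial_def lookup_single zero_word_def when_def)
      then show ?case using step.IH by (auto simp: free_algebra_def lookup_add lookup_gr_scale)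
    qed (simp add: free_algebra_def)
    moreover have "poly_value A_scale A_mult a f = 0" if a: "\<forall>t i. a (t, i) \<in> A_component t" for a
    proof -
      obtain K where "poly_value A_scale A_mult a f =
          (\<Sum>\<beta>\<in>letter_maps n. A_scale (K \<beta>) (poly_value A_scale A_mult (letter_val \<beta>) f))"
        using poly_value_expand[OF n, of a] a f by blast
      moreover have "poly_value A_scale A_mult (letter_val \<beta>) f = 0" if "\<beta> \<in> letter_maps n" for \<beta>
        unfolding coord_eq_0[symmetric]
      proof
        fix k
        have "eval_map n f (\<beta>, k) = 0" using f0 by simp
        then show "coord (poly_value A_scale A_mult (letter_val \<beta>) f) k = 0"
          using that by (simp add: eval_map_def)
      qed
      ultimately show ?thesis by simp
    qed
    ultimately show "f \<in> graded_identities A_scale A_mult A_component"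
      by (simp add: graded_identities_def) }
qed

lemma sum_apply: "sum f S x = (\<Sum>j\<in>S. f j x)" for f :: "'j \<Rightarrow> 'x \<Rightarrow> 'a::comm_monoid_add"
  by (induction S rule: infinite_finite_induct) auto

text \<open>Values supported on \<open>M\<close> are combinations of indicator functions of pairs of
  a map in \<open>M\<close> and one of six coordinates. Taking \<open>M = letter_maps n\<close>
  gives finite dimension; the maps of weight at most 1 give the upper bound.\<close>

lemma eval_map_span:
  fixes M :: "(nat \<Rightarrow> letter) set"
  assumes M: "\<And>f \<beta> k. f \<in> multilinear_polys n \<Longrightarrow>
    eval_map n (f :: (T3, 'a::field) gr_poly) (\<beta>, k) \<noteq> 0 \<Longrightarrow> \<beta> \<in> M"
    and "finite M"
  obtains G where "finite G" "card G \<le> 6 * card M"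
    "(eval_map n :: (T3, 'a) gr_poly \<Rightarrow> _) ` multilinear_polys n \<subseteq> fn.span G"
proof
  let ?T = "eval_map n :: (T3, 'a) gr_poly \<Rightarrow> _"
    and ?U = "multilinear_polys n :: (T3, 'a) gr_poly set"
  define G :: "((nat \<Rightarrow> letter) \<times> (2 \<times> 2 + 2) \<Rightarrow> 'a) set"
    where "G = (\<lambda>j x. of_bool (x = j)) ` (M \<times> UNIV)"
  show "?T ` ?U \<subseteq> fn.span G"
  proof safe
    fix f assume f: "f \<in> ?U"
    have "?T f = (\<Sum>j\<in>M \<times> UNIV. fun_scale (?T f j) (\<lambda>x. of_bool (x = j)))"
    proof
      fix x
      have "(\<Sum>j\<in>M \<times> UNIV. fun_scale (?T f j) (\<lambda>x. of_bool (x = j))) x =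
        (\<Sum>j\<in>M \<times> UNIV. if x = j then ?T f j else 0)"
        unfolding sum_apply by (auto simp: fun_scale_def intro!: sum.cong)
      also have "\<dots> = ?T f x"
        using M[OF f, of "fst x" "snd x"] \<open>finite M\<close> by (cases x) (auto simp: sum.delta)
      finally show "?T f x = (\<Sum>j\<in>M \<times> UNIV. fun_scale (?T f j) (\<lambda>x. of_bool (x = j))) x" ..
    qed
    also have "\<dots> \<in> fn.span G"
      by (intro fn.span_sum fn.span_scale fn.span_base) (auto simp: G_def)
    finally show "?T f \<in> fn.span G" .
  qed
  show "finite G" using \<open>finite M\<close> by (simp add: G_def)
  have "card G \<le> card (M \<times> (UNIV :: (2 \<times> 2 + 2) set))"
    unfolding G_def using \<open>finite M\<close> by (intro card_image_le) simp
  also have "\<dots> = 6 * card M"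
    by (simp add: card_cartesian_product UNIV_Plus_UNIV[symmetric] card_Plus del: UNIV_Plus_UNIV)
  finally show "card G \<le> 6 * card M" .
qed

lemma graded_codim_eq:
  assumes n: "n \<ge> 1"
  shows "graded_codim (A_scale :: 'a::field \<Rightarrow> 'a A_alg \<Rightarrow> 'a A_alg) A_mult A_component n =
    vector_space.dim fun_scale ((eval_map n :: (T3, 'a) gr_poly \<Rightarrow> _) ` multilinear_polys n)"
proof -
  obtain G where G: "finite G" "(eval_map n ::
    (T3, 'a) gr_poly \<Rightarrow> _) ` multilinear_polys n \<subseteq> fn.span G"
    by (rule eval_map_span[of n "letter_maps n", where 'a = 'a])
      (auto simp: eval_map_def split: if_splits)
  have "gr.subspace (multilinear_polys n :: (T3, 'a) gr_poly set)"
    by (simp add: multilinear_polys_def)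
  then show ?thesis
    unfolding graded_codim_def multilinear_Int_identities[OF n]
    by (rule quotient_dim_eq_dim_image[OF linear_eval_map _ G])
qed

subsection \<open>Upper bound\<close>

text \<open>\<open>wt\<close> is the weight of a letter under conjugation by diagonal matrices.\<close>

definition wt :: "letter \<Rightarrow> int" where "wt l = of_bool (row_ix l) - of_bool (col_ix l)"

text \<open>Homogeneity for the grading of the algebra by weights; a vector of the module counts as
  a second column. Zero is homogeneous of every weight.\<close>

definition homog :: "int \<Rightarrow> 'a::field A_alg \<Rightarrow> bool" where
  "homog m p \<longleftrightarrow> (\<forall>i j. fst p $ i $ j \<noteq> 0 \<longrightarrow> m = of_bool (i = 1) - of_bool (j = 1)) \<and>
     (\<forall>i. snd p $ i \<noteq> 0 \<longrightarrow> m = of_bool (i = 1))"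

lemma homog_0: "homog m 0" by (simp add: homog_def)

lemma homog_add: "homog m p \<Longrightarrow> homog m q \<Longrightarrow> homog m (p + q)"
  unfolding homog_def
proof (intro conjI allI impI; elim conjE)
  fix i j assume *: "\<forall>i j. fst p $ i $ j \<noteq> 0 \<longrightarrow> m = of_bool (i = 1) - of_bool (j = 1)"
    "\<forall>i j. fst q $ i $ j \<noteq> 0 \<longrightarrow> m = of_bool (i = 1) - of_bool (j = 1)" and "fst (p + q) $ i $ j \<noteq> 0"
  then have "fst p $ i $ j \<noteq> 0 \<or> fst q $ i $ j \<noteq> 0" by auto
  then show "m = of_bool (i = 1) - of_bool (j = 1)" using * by blast
next
  fix i assume *: "\<forall>i. snd p $ i \<noteq> 0 \<longrightarrow> m = of_bool (i = 1)"
    "\<forall>i. snd q $ i \<noteq> 0 \<longrightarrow> m = of_bool (i = 1)" and "snd (p + q) $ i \<noteq> 0"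
  then have "snd p $ i \<noteq> 0 \<or> snd q $ i \<noteq> 0" by auto
  then show "m = of_bool (i = 1)" using * by blast
qed

lemma homog_scale: "homog m p \<Longrightarrow> homog m (A_scale c p)"
  by (auto simp: homog_def A_scale_def mat_scale_def)

lemma homog_mult:
  assumes p: "homog m p" and q: "homog m' q"
  shows "homog (m + m') (A_mult p q)"
  unfolding homog_def
proof (intro conjI allI impI)
  fix i j assume "fst (A_mult p q) $ i $ j \<noteq> 0"
  then have "(\<Sum>k\<in>UNIV. fst p $ i $ k * fst q $ k $ j) \<noteq> 0"
    by (simp add: A_mult_def matrix_matrix_mult_def)
  then obtain k where "fst p $ i $ k \<noteq> 0" "fst q $ k $ j \<noteq> 0"
    by (auto elim!: sum.not_neutral_contains_not_neutral)
  then have "m = of_bool (i = 1) - of_bool (k = 1)" "m' = of_bool (k = 1) - of_bool (j = 1)"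
    using p q unfolding homog_def by blast+
  then show "m + m' = of_bool (i = 1) - of_bool (j = 1)" by linarith
next
  fix i assume "snd (A_mult p q) $ i \<noteq> 0"
  then have "(\<Sum>k\<in>UNIV. fst p $ i $ k * snd q $ k) \<noteq> 0"
    by (simp add: A_mult_def matrix_vector_mult_def)
  then obtain k where "fst p $ i $ k \<noteq> 0" "snd q $ k \<noteq> 0"
    by (auto elim!: sum.not_neutral_contains_not_neutral)
  then have "m = of_bool (i = 1) - of_bool (k = 1)" "m' = of_bool (k = 1)"
    using p q unfolding homog_def by blast+
  then show "m + m' = of_bool (i = 1)" by linarith
qed

lemma homog_letter_val: "homog (wt (\<beta> i)) (letter_val \<beta> (t, i))"
  by (auto simp: homog_def letter_val_def Letters_def wt_def basis_elem_def deg_of_def row_ix_def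
    col_ix_def
      mat_unit_def idx_def axis_def)

lemma homog_list_product:
  "homog (\<Sum>i\<leftarrow>w. wt (\<beta> i)) (list_product A_mult (map (\<lambda>i. letter_val \<beta> (s i, i)) w))"
proof (induction w)
  case (Cons i w)
  then show ?case
    by (cases w) (auto simp: homog_letter_val intro!: homog_mult)
qed (simp add: homog_0)

lemma homog_poly_value:
  "f \<in> multilinear_polys n \<Longrightarrow> homog (\<Sum>i\<in>{1..n}. wt (\<beta> i)) (poly_value A_scale A_mult
    (letter_val \<beta>) f)"
  unfolding multilinear_polys_eq
proof (induction rule: gr.span_induct_alt)
  case (step c f g)
  then obtain s w where w: "distinct w" "set w = {1..n}" and f: "f = monomial s w" by blast
  have "(\<Sum>i\<in>{1..n}. wt (\<beta> i)) = (\<Sum>i\<leftarrow>w. wt (\<beta> i))"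
    using w by (simp add: sum_list_distinct_conv_sum_set)
  then have "homog (\<Sum>i\<in>{1..n}. wt (\<beta> i)) (poly_value A_scale A_mult (letter_val \<beta>) f)"
    using homog_list_product[of \<beta> w s] by (simp add: f monomial_def A.poly_value_single o_def)
  then show ?case using step.IH by (simp add: A.poly_value_add A.poly_value_gr_scale homog_add
    homog_scale)
qed (simp add: poly_value_def homog_0)

lemma card_letter_maps_weight_le:
  "card {\<beta> \<in> letter_maps n. (\<Sum>i\<in>{1..n}. wt (\<beta> i)) \<le> 1} \<le> sqrt 2 * (3 + 2 * sqrt 2) ^ n"
proof -
  define t :: real where "t = 1 / sqrt 2"
  have t: "t > 0" "t \<le> 1" by (simp_all add: t_def)
  let ?M = "{\<beta> \<in> letter_maps n. (\<Sum>i\<in>{1..n}. wt (\<beta> i)) \<le> 1}"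
  have "t * card ?M = (\<Sum>\<beta>\<in>?M. t)" by simp
  \<comment> \<open>As \<open>t \<le> 1\<close>, a map of weight at most 1 contributes at least
    \<open>t\<close>.\<close>
  also have "\<dots> \<le> (\<Sum>\<beta>\<in>?M. \<Prod>i\<in>{1..n}. t powr wt (\<beta> i))"
  proof (rule sum_mono)
    fix \<beta> assume "\<beta> \<in> ?M"
    then have "t powr 1 \<le> t powr of_int (\<Sum>i\<in>{1..n}. wt (\<beta> i))"
      using t by (intro powr_mono') (auto simp flip: of_int_sum)
    then show "t \<le> (\<Prod>i\<in>{1..n}. t powr wt (\<beta> i))"
      using t by (simp add: powr_sum)
  qed
  also have "\<dots> \<le> (\<Sum>\<beta>\<in>letter_maps n. \<Prod>i\<in>{1..n}. t powr wt (\<beta> i))"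
    by (intro sum_mono2) (auto intro!: prod_nonneg)
  also have "\<dots> = (\<Prod>i\<in>{1..n}. \<Sum>l\<in>Letters. t powr wt l)"
    unfolding letter_maps_def by (rule prod_sum_PiE[symmetric]) auto
  \<comment> \<open>Three letters have weight 0, two have weight 1 and one has weight -1. The value
    of \<open>t\<close> minimises 2t + 1/t.\<close>
  also have "(\<Sum>l\<in>Letters. t powr wt l) = 3 + 2 * sqrt 2"
    using t by (simp add: Letters_def wt_def row_ix_def col_ix_def powr_minus t_def field_simps)
  finally show ?thesis by (simp add: t_def field_simps)
qed

text \<open>A homogeneous element with a nonzero coordinate has weight at most 1, so only the maps
  counted in \<open>card_letter_maps_weight_le\<close> matter, each with six coordinates.\<close>

lemma graded_codim_upper:
  assumes "n \<ge> 1"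
  shows "graded_codim (A_scale :: 'a::field \<Rightarrow> 'a A_alg \<Rightarrow> 'a A_alg) A_mult A_component n \<le>
    6 * sqrt 2 * (3 + 2 * sqrt 2) ^ n"
proof -
  let ?M = "{\<beta> \<in> letter_maps n. (\<Sum>i\<in>{1..n}. wt (\<beta> i)) \<le> 1}"
  have "\<beta> \<in> ?M" if f: "f \<in> multilinear_polys n" and "eval_map n f (\<beta>, k) \<noteq> 0"
    for f :: "(T3, 'a) gr_poly" and \<beta> k
  proof -
    have hom: "homog (\<Sum>i\<in>{1..n}. wt (\<beta> i)) (poly_value A_scale A_mult (letter_val \<beta>) f)"
      by (rule homog_poly_value[OF f])
    have \<beta>: "\<beta> \<in> letter_maps n" and nz: "coord (poly_value A_scale A_mult (letter_val \<beta>) f) k \<noteq> 0"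
      using that by (auto simp: eval_map_def split: if_splits)
    have "(\<Sum>i\<in>{1..n}. wt (\<beta> i)) \<le> 1"
    proof (cases k)
      case (Inl ij)
      then show ?thesis using nz hom by (cases ij)
        (auto simp: coord_def homog_def of_bool_def split: if_splits)
    next
      case (Inr i)
      then show ?thesis using nz hom by (auto simp: coord_def homog_def of_bool_def split:
        if_splits)
    qed
    then show "\<beta> \<in> ?M" using \<beta> by simp
  qed
  then obtain G where G: "finite G" "card G \<le> 6 * card ?M"
    "(eval_map n :: (T3, 'a) gr_poly \<Rightarrow> _) ` multilinear_polys n \<subseteq> fn.span G"
    by (rule eval_map_span[where n = n and M = ?M]) simp_all
  then have "graded_codim (A_scale :: 'a::field \<Rightarrow> 'a A_alg \<Rightarrow> 'a A_alg) A_mult A_component n \<le>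
    6 * card ?M"
    unfolding graded_codim_eq[OF assms] using fn.dim_le_card[OF G(3,1)] by linarith
  then have "real (graded_codim (A_scale :: 'a::field \<Rightarrow> 'a A_alg \<Rightarrow> 'a A_alg) A_mult A_component n) \<le>
    6 * real (card ?M)" by linarith
  then show ?thesis using card_letter_maps_weight_le[of n] by linarith
qed

subsection \<open>Antisymmetrised monomials\<close>

definition below_match :: "(nat \<Rightarrow> nat) \<Rightarrow> nat set \<Rightarrow> nat set \<Rightarrow> bool" where
  "below_match \<gamma> C V \<longleftrightarrow> inj_on \<gamma> C \<and> C \<subseteq> V \<and> \<gamma> ` C \<subseteq> V - C \<and> (\<forall>c\<in>C. \<gamma> c < c)"

text \<open>\<open>C'\<close> contains exactly one element of each pair of \<open>c\<close> and
  \<open>\<gamma> c\<close>, while \<open>C\<close> contains the larger one of each. This supplies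
  the order for triangularity.\<close>

lemma below_match_sum_le:
  assumes m: "below_match \<gamma> C V" and "finite C"
    and C': "C' \<subseteq> C \<union> \<gamma> ` C" "\<And>c. c \<in> C \<Longrightarrow> c \<in> C' \<longleftrightarrow> \<gamma> c \<notin> C'"
  shows "\<Sum>C' \<le> \<Sum>C" and "\<Sum>C' = \<Sum>C \<Longrightarrow> C' = C"
proof -
  define h where "h c = (if c \<in> C' then c else \<gamma> c)" for c
  have disj: "\<gamma> c \<notin> C" if "c \<in> C" for c using m that by (auto simp: below_match_def)
  have inj: "inj_on h C"
    using m disj unfolding below_match_def inj_on_def h_def by metis
  have img: "h ` C = C'"
  proof
    show "h ` C \<subseteq> C'" using C' by (auto simp: h_def)
    show "C' \<subseteq> h ` C"
    proof
      fix x assume x: "x \<in> C'"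
      then consider "x \<in> C" | c where "c \<in> C" "x = \<gamma> c" using C' by blast
      then show "x \<in> h ` C"
        using x C'(2) by cases (force simp: h_def)+
    qed
  qed
  have h: "\<Sum>C' = (\<Sum>c\<in>C. h c)" using inj by (simp flip: img add: sum.reindex)
  have le: "h c \<le> c" if "c \<in> C" for c
    using m that by (auto simp: below_match_def h_def less_imp_le)
  show "\<Sum>C' \<le> \<Sum>C" unfolding h using le by (rule sum_mono)
  assume eq: "\<Sum>C' = \<Sum>C"
  have "c \<in> C'" if "c \<in> C" for c
  proof (rule ccontr)
    assume "c \<notin> C'"
    then have "h c < c" using m that by (auto simp: below_match_def h_def)
    then have "(\<Sum>c\<in>C. h c) < \<Sum>C" using that le \<open>finite C\<close> by (intro sum_strict_mono_ex1) auto
    then show False using eq h by simp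
  qed
  then show "C' = C" using img by (auto simp: h_def)
qed

definition swap_pairs :: "('x \<Rightarrow> 'x) \<Rightarrow> 'x set \<Rightarrow> 'x \<Rightarrow> 'x" where
  "swap_pairs \<gamma> G x = (if x \<in> G then \<gamma> x else if x \<in> \<gamma> ` G then inv_into G \<gamma> x else x)"

lemma swap_pairs:
  assumes m: "below_match \<gamma> C V" and G: "G \<subseteq> C"
  shows "c \<in> C \<Longrightarrow> swap_pairs \<gamma> G c = (if c \<in> G then \<gamma> c else c)"
    and "c \<in> C \<Longrightarrow> swap_pairs \<gamma> G (\<gamma> c) = (if c \<in> G then c else \<gamma> c)"
    and "x \<notin> C \<Longrightarrow> x \<notin> \<gamma> ` C \<Longrightarrow> swap_pairs \<gamma> G x = x"
    and "swap_pairs \<gamma> G (swap_pairs \<gamma> G x) = x"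
    and "x \<in> V \<Longrightarrow> swap_pairs \<gamma> G x \<in> V"
proof -
  have inj: "inj_on \<gamma> C" "inj_on \<gamma> G" and disj: "\<And>c c'. c \<in> C \<Longrightarrow> c' \<in> C \<Longrightarrow> \<gamma> c \<noteq> c'"
    using m G by (auto simp: below_match_def intro: inj_on_subset)
  show 1: "swap_pairs \<gamma> G c = (if c \<in> G then \<gamma> c else c)" if "c \<in> C" for c
    using that disj G by (fastforce simp: swap_pairs_def)
  show 2: "swap_pairs \<gamma> G (\<gamma> c) = (if c \<in> G then c else \<gamma> c)" if "c \<in> C" for c
    using that disj[OF that] G inj by (auto simp: swap_pairs_def inj_on_image_mem_iff)
  show 3: "swap_pairs \<gamma> G x = x" if "x \<notin> C" "x \<notin> \<gamma> ` C" for x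
    using that G by (auto simp: swap_pairs_def)
  show "swap_pairs \<gamma> G (swap_pairs \<gamma> G x) = x"
    by (cases "x \<in> C"; cases "x \<in> \<gamma> ` C") (auto simp: 1 2 3)
  show "swap_pairs \<gamma> G x \<in> V" if "x \<in> V"
    using that m by (cases "x \<in> C"; cases "x \<in> \<gamma> ` C") (auto simp: 1 2 3 below_match_def)
qed

text \<open>Exchanging \<open>c\<close> and \<open>\<gamma> c\<close> does not change
  \<open>b\<close>, so the terms of \<open>G\<close> and \<open>insert c G\<close> cancel.\<close>

lemma alternating_sum_swap_eq_0:
  fixes h :: "(nat \<Rightarrow> bool) \<Rightarrow> 'a::comm_ring_1"
  assumes m: "below_match \<gamma> C V" and "finite C" and c: "c \<in> C" "b c = b (\<gamma> c)"
  shows "(\<Sum>G\<in>Pow C. (-1) ^ card G * h (b \<circ> swap_pairs \<gamma> G)) = 0"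
proof -
  define C0 where "C0 = C - {c}"
  have C: "C = insert c C0" "c \<notin> C0" "finite C0" using c \<open>finite C\<close> by (auto simp: C0_def)
  have eq: "b \<circ> swap_pairs \<gamma> (insert c G) = b \<circ> swap_pairs \<gamma> G" if G: "G \<in> Pow C0" for G
  proof
    fix x
    have sub: "G \<subseteq> C" "insert c G \<subseteq> C" "c \<notin> G" using G C by auto
    note sw = swap_pairs[OF m sub(1)] swap_pairs[OF m sub(2)]
    consider "x \<in> C" | y where "y \<in> C" "x = \<gamma> y" | "x \<notin> C" "x \<notin> \<gamma> ` C" by blast
    then show "(b \<circ> swap_pairs \<gamma> (insert c G)) x = (b \<circ> swap_pairs \<gamma> G) x"
      using c sub(3) by cases (auto simp: sw)
  qed
  have "(\<Sum>G\<in>Pow C. (-1) ^ card G * h (b \<circ> swap_pairs \<gamma> G)) =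
     (\<Sum>G\<in>Pow C0. (-1) ^ card G * h (b \<circ> swap_pairs \<gamma> G)) +
     (\<Sum>G\<in>Pow C0. (-1) ^ card (insert c G) * h (b \<circ> swap_pairs \<gamma> (insert c G)))"
  proof -
    have "inj_on (insert c) (Pow C0)" "Pow C0 \<inter> insert c ` Pow C0 = {}"
      using C(2) by (auto simp: inj_on_def)
    then show ?thesis
      unfolding C(1) Pow_insert using C(3) by (simp add: sum.union_disjoint sum.reindex)
  qed
  also have "(\<Sum>G\<in>Pow C0. (-1) ^ card (insert c G) * h (b \<circ> swap_pairs \<gamma> (insert c G))) =
      (\<Sum>G\<in>Pow C0. - ((-1) ^ card G * h (b \<circ> swap_pairs \<gamma> G)))"
  proof (intro sum.cong refl)
    fix G assume G: "G \<in> Pow C0"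
    then have "card (insert c G) = Suc (card G)"
      using C by (subst card_insert_disjoint) (auto intro: finite_subset)
    then show "(-1) ^ card (insert c G) * h (b \<circ> swap_pairs \<gamma> (insert c G)) =
      - ((-1) ^ card G * h (b \<circ> swap_pairs \<gamma> G))" using eq[OF G] by simp
  qed
  finally show ?thesis by (simp only: sum_negf add.right_inverse)
qed

text \<open>A triple \<open>(S, R, C)\<close> encodes an assignment of letters: \<open>S\<close> is the set of variables of degree
  \<open>E1\<close>,
  \<open>R\<close> the set of those with column index 1, and \<open>C\<close> the set of variables
  with row index 1. In a wiring, \<open>\<tau>\<close> sends each pair \<open>{\<delta> d, d}\<close> to a pair \<open>{c, \<gamma> c}\<close>, so
  that antisymmetrising over the swaps of \<open>c\<close> and \<open>\<gamma> c\<close> controls both \<open>C\<close> and \<open>R\<close>.\<close>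

definition wiring :: "nat set \<Rightarrow> nat set \<Rightarrow> nat set \<Rightarrow> nat set \<Rightarrow> (nat \<Rightarrow> nat) \<Rightarrow> (nat \<Rightarrow> nat) \<Rightarrow>
  (nat \<Rightarrow> nat) \<Rightarrow> bool" where
  "wiring V S R C \<gamma> \<delta> \<tau> \<longleftrightarrow> below_match \<gamma> C V \<and> R \<subseteq> S \<and> below_match \<delta> (S - R) S \<and> bij_betw \<tau> R C \<and>
    (\<forall>d\<in>S - R. \<tau> d = \<gamma> (\<tau> (\<delta> d)) \<and> d < \<tau> d) \<and> (\<forall>r\<in>R. r < \<gamma> (\<tau> r))"

text \<open>The condition of \<open>exists_path_word\<close>. For injective \<open>\<tau>\<close>
  with values in \<open>V\<close> it says that \<open>\<tau>\<close> maps the variables in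
  \<open>S\<close> of column index 1 onto the variables in \<open>V\<close> of row index 1.\<close>

definition links :: "nat set \<Rightarrow> nat set \<Rightarrow> (nat \<Rightarrow> nat) \<Rightarrow> (nat \<Rightarrow> bool) \<Rightarrow> (nat \<Rightarrow> bool) \<Rightarrow> bool" where
  "links V S \<tau> c r \<longleftrightarrow> (\<forall>i\<in>S. r i = c (\<tau> i)) \<and> (\<forall>j\<in>V - \<tau> ` S. \<not> c j)"

section \<open>Coefficients of a wired triple\<close>

locale wired =
  fixes V S R C \<gamma> \<delta> \<tau>
  assumes w: "wiring V S R C \<gamma> \<delta> \<tau>" and fin: "finite V" "finite S"
begin

lemma \<gamma>: "below_match \<gamma> C V" and \<delta>: "below_match \<delta> (S - R) S" and RS: "R \<subseteq> S"
  and \<tau>R: "bij_betw \<tau> R C" and \<tau>D: "d \<in> S - R \<Longrightarrow> \<tau> d = \<gamma> (\<tau> (\<delta> d))"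
  and less: "d \<in> S - R \<Longrightarrow> d < \<tau> d" "r \<in> R \<Longrightarrow> r < \<gamma> (\<tau> r)"
  using w unfolding wiring_def by blast+

lemma CV: "C \<subseteq> V" "finite C" and \<gamma>V: "c \<in> C \<Longrightarrow> \<gamma> c \<in> V" "c \<in> C \<Longrightarrow> \<gamma> c \<notin> C" "c \<in> C \<Longrightarrow> \<gamma> c < c"
  using \<gamma> fin by (auto simp: below_match_def intro: finite_subset)

lemma \<delta>R: "d \<in> S - R \<Longrightarrow> \<delta> d \<in> R" using \<delta> by (auto simp: below_match_def)

lemma \<tau>C: "r \<in> R \<Longrightarrow> \<tau> r \<in> C" using \<tau>R by (auto simp: bij_betw_def)

lemma inj_\<gamma>: "c \<in> C \<Longrightarrow> c' \<in> C \<Longrightarrow> \<gamma> c = \<gamma> c' \<longleftrightarrow> c = c'"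
  using \<gamma> by (auto simp: below_match_def inj_on_eq_iff)

lemma inj_\<tau>R: "r \<in> R \<Longrightarrow> r' \<in> R \<Longrightarrow> \<tau> r = \<tau> r' \<longleftrightarrow> r = r'"
  using \<tau>R by (auto simp: bij_betw_def inj_on_eq_iff)

lemma inj_\<delta>: "d \<in> S - R \<Longrightarrow> d' \<in> S - R \<Longrightarrow> \<delta> d = \<delta> d' \<longleftrightarrow> d = d'"
  using \<delta> by (auto simp: below_match_def inj_on_eq_iff)

text \<open>\<open>R\<close> goes bijectively to \<open>C\<close>, and \<open>S - R\<close>
  injectively into the image of \<open>C\<close> under \<open>\<gamma>\<close>, which is disjoint
  from \<open>C\<close>.\<close>

lemma inj_\<tau>: "inj_on \<tau> S"
proof (rule inj_onI)
  fix x y assume xy: "x \<in> S" "y \<in> S" "\<tau> x = \<tau> y"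
  show "x = y"
  proof (cases "x \<in> R"; cases "y \<in> R")
    assume "x \<in> R" "y \<in> R" then show ?thesis using inj_\<tau>R xy by blast
  next
    assume "x \<in> R" "y \<notin> R"
    then show ?thesis using \<tau>D[of y] \<tau>C[of x] \<tau>C[OF \<delta>R[of y]] \<gamma>V(2) xy by auto
  next
    assume "x \<notin> R" "y \<in> R"
    then show ?thesis using \<tau>D[of x] \<tau>C[of y] \<tau>C[OF \<delta>R[of x]] \<gamma>V(2) xy by auto
  next
    assume *: "x \<notin> R" "y \<notin> R"
    then have "\<tau> (\<delta> x) = \<tau> (\<delta> y)" using xy \<tau>D[of x] \<tau>D[of y] inj_\<gamma> \<tau>C \<delta>R by auto
    then show ?thesis using * xy inj_\<tau>R[OF \<delta>R \<delta>R] inj_\<delta> by auto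
  qed
qed

text \<open>A wiring puts each \<open>i\<close> below the smaller element of the pair containing
  \<open>\<tau> i\<close>. So the hypotheses of \<open>exists_path_word\<close> survive every
  swap.\<close>

lemma swap_\<tau>:
  assumes G: "G \<subseteq> C" and i: "i \<in> S"
  shows "swap_pairs \<gamma> G (\<tau> i) \<in> V" "i < swap_pairs \<gamma> G (\<tau> i)"
proof -
  note sw = swap_pairs[OF \<gamma> G]
  show "swap_pairs \<gamma> G (\<tau> i) \<in> V"
    using i by (cases "i \<in> R") (use \<tau>C CV \<tau>D \<delta>R \<gamma>V in \<open>auto intro!: sw(5)\<close>)
  show "i < swap_pairs \<gamma> G (\<tau> i)"
  proof (cases "i \<in> R")
    case True
    then show ?thesis using less(2)[OF True] \<tau>C[OF True] \<gamma>V(3)[OF \<tau>C[OF True]] by (auto simp: sw)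
  next
    case False
    then have i': "i \<in> S - R" using i by simp
    show ?thesis using less(1)[OF i'] \<tau>C[OF \<delta>R[OF i']] \<gamma>V(3)[OF \<tau>C[OF \<delta>R[OF i']]] \<tau>D[OF i']
      by (auto simp: sw)
  qed
qed

text \<open>The swap is an involution of \<open>V\<close>, hence can be moved from the word to the
  row indices.\<close>

lemma links_swap:
  assumes G: "G \<subseteq> C"
  shows "links V S (swap_pairs \<gamma> G \<circ> \<tau>) c r \<longleftrightarrow> links V S \<tau> (c \<circ> swap_pairs \<gamma> G) r"
proof -
  note sw = swap_pairs[OF \<gamma> G]
  have "(\<forall>j\<in>V - (swap_pairs \<gamma> G \<circ> \<tau>) ` S. \<not> c j) \<longleftrightarrow> (\<forall>j\<in>V - \<tau> ` S. \<not> c (swap_pairs \<gamma> G j))"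
  proof (intro iffI ballI)
    fix j assume *: "\<forall>j\<in>V - (swap_pairs \<gamma> G \<circ> \<tau>) ` S. \<not> c j" and j: "j \<in> V - \<tau> ` S"
    have "swap_pairs \<gamma> G j \<notin> (swap_pairs \<gamma> G \<circ> \<tau>) ` S"
      using j sw(4) by (auto simp: o_def) (metis imageI)
    then show "\<not> c (swap_pairs \<gamma> G j)" using * j sw(5) by blast
  next
    fix j assume *: "\<forall>j\<in>V - \<tau> ` S. \<not> c (swap_pairs \<gamma> G j)" and j: "j \<in> V - (swap_pairs \<gamma> G \<circ> \<tau>) ` S"
    have "swap_pairs \<gamma> G j \<notin> \<tau> ` S"
      using j sw(4) by (auto simp: o_def) (metis imageI)
    then have "\<not> c (swap_pairs \<gamma> G (swap_pairs \<gamma> G j))" using * j sw(5) by blast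
    then show "\<not> c j" by (simp add: sw(4))
  qed
  then show ?thesis by (simp add: links_def)
qed

text \<open>The (2,2)-entry of the antisymmetrised monomial, by \<open>coeff_realized\<close>; the
  sign is that of a product of \<open>card G\<close> transpositions.\<close>

definition coeff :: "(nat \<Rightarrow> bool) \<Rightarrow> (nat \<Rightarrow> bool) \<Rightarrow> 'a::comm_ring_1" where
  "coeff c r = (\<Sum>G\<in>Pow C. (-1) ^ card G * of_bool (links V S (swap_pairs \<gamma> G \<circ> \<tau>) c r))"

text \<open>Only the empty \<open>G\<close> contributes: swapping \<open>c = \<tau> r\<close> sends
  \<open>r\<close> from \<open>R\<close> to \<open>\<gamma> c\<close>, which lies outside
  \<open>C\<close>.\<close>

lemma coeff_self: "coeff (\<lambda>j. j \<in> C) (\<lambda>i. i \<in> R) = 1"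
proof -
  have "links V S (swap_pairs \<gamma> G \<circ> \<tau>) (\<lambda>j. j \<in> C) (\<lambda>i. i \<in> R) \<longleftrightarrow> G = {}" if G: "G \<subseteq> C" for G
  proof
    assume l: "links V S (swap_pairs \<gamma> G \<circ> \<tau>) (\<lambda>j. j \<in> C) (\<lambda>i. i \<in> R)"
    show "G = {}"
    proof (rule ccontr)
      assume "G \<noteq> {}"
      then obtain c where c: "c \<in> G" "c \<in> C" using G by auto
      then obtain r where r: "r \<in> R" "c = \<tau> r" using \<tau>R by (auto simp: bij_betw_def)
      have "(r \<in> R) = (swap_pairs \<gamma> G (\<tau> r) \<in> C)" using l r RS by (auto simp: links_def)
      then show False using r c \<gamma>V by (simp add: swap_pairs[OF \<gamma> G])
    qed
  next
    assume "G = {}"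
    moreover have "(i \<in> R) = (\<tau> i \<in> C)" if "i \<in> S" for i
      using that \<tau>C \<tau>D[of i] \<tau>C[OF \<delta>R[of i]] \<gamma>V(2)[of "\<tau> (\<delta> i)"] by (cases "i \<in> R") auto
    moreover have "j \<notin> C" if "j \<notin> \<tau> ` S" for j
      using that \<tau>R RS by (auto simp: bij_betw_def)
    ultimately show "links V S (swap_pairs \<gamma> G \<circ> \<tau>) (\<lambda>j. j \<in> C) (\<lambda>i. i \<in> R)"
      by (simp add: links_def swap_pairs_def o_def)
  qed
  then have "coeff (\<lambda>j. j \<in> C) (\<lambda>i. i \<in> R) = (\<Sum>G\<in>Pow C. if G = {} then 1 else 0 :: 'a)"
    unfolding coeff_def by (intro sum.cong) auto
  also have "\<dots> = 1" using CV by (simp add: sum.delta)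
  finally show ?thesis .
qed

text \<open>Antisymmetry forces \<open>C'\<close> to split each pair at \<open>C\<close>, and the
  links carry this over to \<open>D'\<close> and the pairs given by \<open>\<delta>\<close>. Then
  \<open>below_match_sum_le\<close> applies to both.\<close>

lemma coeff_nonzero:
  assumes nz: "coeff c r \<noteq> (0 :: 'a::comm_ring_1)"
  defines "C' \<equiv> {j \<in> V. c j}" and "D' \<equiv> {i \<in> S. \<not> r i}"
  shows "\<Sum>C' + \<Sum>D' < \<Sum>C + \<Sum>(S - R) \<or> C' = C \<and> D' = S - R"
proof -
  have coeff: "coeff c r = (\<Sum>G\<in>Pow C. (-1) ^ card G * (of_bool (links V S \<tau>
    (c \<circ> swap_pairs \<gamma> G) r) :: 'a))"
    unfolding coeff_def by (intro sum.cong refl) (simp add: links_swap)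
  have alt: "c x \<longleftrightarrow> \<not> c (\<gamma> x)" if "x \<in> C" for x
    using alternating_sum_swap_eq_0[OF \<gamma> CV(2) that, of c "\<lambda>c. of_bool
      (links V S \<tau> c r) :: 'a"] nz coeff by auto
  obtain G where G: "G \<subseteq> C" and l: "links V S \<tau> (c \<circ> swap_pairs \<gamma> G) r"
  proof -
    obtain G where "G \<in> Pow C" "(-1) ^ card G * (of_bool (links V S \<tau>
      (c \<circ> swap_pairs \<gamma> G) r) :: 'a) \<noteq> 0"
      using nz unfolding coeff by (rule sum.not_neutral_contains_not_neutral)
    then show thesis by (intro that[of G]) (auto simp: of_bool_def split: if_splits)
  qed
  note sw = swap_pairs[OF \<gamma> G]
  let ?c = "c \<circ> swap_pairs \<gamma> G"
  have alt': "?c x \<longleftrightarrow> \<not> ?c (\<gamma> x)" if "x \<in> C" for x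
    using alt[OF that] that by (simp add: sw)
  have \<tau>S: "\<tau> i \<in> C \<union> \<gamma> ` C" if "i \<in> S" for i
    using that \<tau>C \<tau>D[of i] \<delta>R[of i] by auto
  have C'sub: "C' \<subseteq> C \<union> \<gamma> ` C"
  proof
    fix x assume "x \<in> C'"
    then have x: "x \<in> V" "c x" by (auto simp: C'_def)
    show "x \<in> C \<union> \<gamma> ` C"
    proof (rule ccontr)
      assume *: "x \<notin> C \<union> \<gamma> ` C"
      then have "x \<notin> \<tau> ` S" using \<tau>S by auto
      then have "\<not> ?c x" using l x by (auto simp: links_def)
      then show False using * x by (simp add: sw)
    qed
  qed
  have C'alt: "x \<in> C' \<longleftrightarrow> \<gamma> x \<notin> C'" if "x \<in> C" for x
    using alt[OF that] that CV \<gamma>V by (auto simp: C'_def)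
  have r: "r i = ?c (\<tau> i)" if "i \<in> S" for i using l that by (simp add: links_def)
  have D'alt: "d \<in> D' \<longleftrightarrow> \<delta> d \<notin> D'" if d: "d \<in> S - R" for d
    using r[of d] r[of "\<delta> d"] alt'[OF \<tau>C[OF \<delta>R[OF d]]] \<tau>D[OF d] \<delta>R[OF d] RS d by (auto simp: D'_def)
  have D'sub: "D' \<subseteq> (S - R) \<union> \<delta> ` (S - R)"
  proof (rule ccontr)
    assume "\<not> ?thesis"
    then obtain i where i: "i \<in> R" "\<not> r i" "i \<notin> \<delta> ` (S - R)" by (auto simp: D'_def)
    then have iS: "i \<in> S" using RS by auto
    \<comment> \<open>As \<open>i\<close> has no partner under \<open>\<delta>\<close>, the lower
      element of the pair at \<open>\<tau> i\<close> is not hit by \<open>\<tau>\<close>. So its row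
      index is 2, that of \<open>\<tau> i\<close> is 1, and \<open>r i\<close> holds.\<close>
    have "\<gamma> (\<tau> i) \<notin> \<tau> ` S"
    proof
      assume "\<gamma> (\<tau> i) \<in> \<tau> ` S"
      then obtain d where d: "d \<in> S" "\<tau> d = \<gamma> (\<tau> i)" by auto
      then have d': "d \<in> S - R" using \<gamma>V(2)[OF \<tau>C[OF i(1)]] \<tau>C[of d] by auto
      then have "\<tau> (\<delta> d) = \<tau> i" using \<tau>D[OF d'] d inj_\<gamma> \<tau>C[OF i(1)] \<tau>C[OF \<delta>R[OF d']] by auto
      then have "\<delta> d = i" using inj_\<tau>R i(1) \<delta>R[OF d'] by blast
      then show False using i d' by blast
    qed
    then have "\<not> ?c (\<gamma> (\<tau> i))" using l \<gamma>V(1)[OF \<tau>C[OF i(1)]] by (auto simp: links_def)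
    then have "?c (\<tau> i)" using alt'[OF \<tau>C[OF i(1)]] by blast
    then show False using r[OF iS] i by blast
  qed
  note 1 = below_match_sum_le[OF \<gamma> CV(2) C'sub C'alt]
  have finD: "finite (S - R)" using fin by simp
  note 2 = below_match_sum_le[OF \<delta> finD D'sub D'alt]
  show ?thesis using 1 2 by linarith
qed

end

section \<open>Polynomials realising the coefficients\<close>

lemma list_product_eq_0:
  fixes xs :: "'a::field A_alg list"
  assumes "0 \<in> set xs"
  shows "list_product A_mult xs = 0"
proof -
  have z: "A_mult 0 y = 0" "A_mult y 0 = 0" for y :: "'a A_alg"
    by (auto simp: A_mult_def zero_prod_def)
  show ?thesis using assms
  proof (induction xs)
    case (Cons x xs)
    then show ?case by (cases xs) (auto simp: z)
  qed simp
qed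

lemma compat_map: "compat c r s (map \<beta> xs) e \<longleftrightarrow> compat (c \<circ> \<beta>) (r \<circ> \<beta>) s xs e"
  by (induction xs arbitrary: s) auto

lemma eval_map_monomial:
  assumes \<beta>: "\<beta> \<in> letter_maps n" and w: "set w = {1..n}" and n: "n \<ge> 1"
  shows "eval_map n (monomial s w :: (T3, 'a::field) gr_poly) (\<beta>, Inl (2, 2)) =
    of_bool ((\<forall>i\<in>{1..n}. deg_of (\<beta> i) = s i) \<and> compat (row_ix \<circ> \<beta>) (col_ix \<circ> \<beta>) False w False)"
proof -
  have val: "eval_map n (monomial s w :: (T3, 'a) gr_poly) (\<beta>, Inl (2, 2)) =
     fst (list_product A_mult (map (\<lambda>i. letter_val \<beta> (s i, i) :: 'a A_alg) w)) $ 2 $ 2"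
    using \<beta> by (simp add: eval_map_def monomial_def A.poly_value_single coord_def o_def)
  have w0: "w \<noteq> []" using w n by auto
  have in_L: "\<beta> i \<in> Letters" if "i \<in> set w" for i using \<beta> that w by (auto simp: letter_maps_def)
  show ?thesis
  proof (cases "\<forall>i\<in>{1..n}. deg_of (\<beta> i) = s i")
    case True
    then have m: "map (\<lambda>i. letter_val \<beta> (s i, i) :: 'a A_alg) w = map basis_elem (map \<beta> w)"
      using in_L w by (auto simp: letter_val_def)
    have "map \<beta> w \<noteq> []" "idx False = 2" using w0 by (simp_all add: idx_def)
    then show ?thesis
      using True fst_list_product[of "map \<beta> w" False False, where 'a = 'a] unfolding val m
      by (simp add: compat_map del: map_map)
  next
    case False
    then have "0 \<in> set (map (\<lambda>i. letter_val \<beta> (s i, i) :: 'a A_alg) w)"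
      using w by (force simp: letter_val_def)
    note z = list_product_eq_0[OF this]
    show ?thesis using False unfolding val z by auto
  qed
qed

text \<open>The polynomial is the alternating sum of the words that \<open>exists_path_word\<close>
  provides for the swapped maps, with degrees prescribed by \<open>S\<close>.\<close>

lemma (in wired) coeff_realized:
  assumes V: "V = {1..n}" and S: "S \<subseteq> V" and n: "n \<ge> 1"
  shows "\<exists>f\<in>multilinear_polys n. \<forall>\<beta>\<in>letter_maps n. eval_map n (f :: (T3, 'a::field) gr_poly)
    (\<beta>, Inl (2, 2)) =
    of_bool ({i \<in> V. deg_of (\<beta> i) = E1} = S) * coeff (row_ix \<circ> \<beta>) (col_ix \<circ> \<beta>)"
proof -
  interpret L: Vector_Spaces.linear gr_scale fun_scale "eval_map n :: (T3, 'a) gr_poly \<Rightarrow> _"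
    by (rule linear_eval_map)
  define s where "s i = (if i \<in> S then E1 else E2)" for i
  have "\<exists>w. distinct w \<and> set w = V \<and> (\<forall>c r. (\<forall>i\<in>V - S. \<not> r i) \<longrightarrow>
    (compat c r False w False \<longleftrightarrow> links V S (swap_pairs \<gamma> G \<circ> \<tau>) c r))" if G: "G \<subseteq> C" for G
    unfolding links_def
  proof (rule exists_path_word[OF fin(1) S])
    show "inj_on (swap_pairs \<gamma> G \<circ> \<tau>) S"
      by (intro comp_inj_on inj_\<tau> inj_onI) (metis swap_pairs(4)[OF \<gamma> G])
  qed (use swap_\<tau>[OF G] in auto)
  then obtain w where w: "\<And>G. G \<subseteq> C \<Longrightarrow> distinct (w G) \<and> set (w G) = V"
    and comp: "\<And>G c r. G \<subseteq> C \<Longrightarrow> \<forall>i\<in>V - S. \<not> r i \<Longrightarrow>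
      compat c r False (w G) False \<longleftrightarrow> links V S (swap_pairs \<gamma> G \<circ> \<tau>) c r" by metis
  define f :: "(T3, 'a) gr_poly" where "f = (\<Sum>G\<in>Pow C. gr_scale ((-1) ^ card G) (monomial s (w G)))"
  have "f \<in> multilinear_polys n"
    unfolding f_def multilinear_polys_eq using w V
    by (intro gr.span_sum gr.span_scale gr.span_base) auto
  moreover have "eval_map n f (\<beta>, Inl (2, 2)) =
    of_bool ({i \<in> V. deg_of (\<beta> i) = E1} = S) * coeff (row_ix \<circ> \<beta>)
      (col_ix \<circ> \<beta>)" if \<beta>: "\<beta> \<in> letter_maps n" for \<beta>
  proof -
    have types: "(\<forall>i\<in>{1..n}. deg_of (\<beta> i) = s i) \<longleftrightarrow> {i \<in> V. deg_of (\<beta> i) = E1} = S"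
    proof -
      have "deg_of (\<beta> i) = s i \<longleftrightarrow> (deg_of (\<beta> i) = E1 \<longleftrightarrow> i \<in> S)" for i
        by (cases "deg_of (\<beta> i)") (simp_all add: s_def)
      then show ?thesis using S V by blast
    qed
    \<comment> \<open>Letters of degree \<open>E2\<close> have column index 2, as
      \<open>exists_path_word\<close> demands outside \<open>S\<close>.\<close>
    have row: "\<forall>i\<in>V - S. \<not> (col_ix \<circ> \<beta>) i" if "{i \<in> V. deg_of (\<beta> i) = E1} = S"
    proof
      fix i assume "i \<in> V - S"
      then have "\<beta> i \<in> Letters" "deg_of (\<beta> i) \<noteq> E1" using \<beta> that V by (auto simp: letter_maps_def)
      then show "\<not> (col_ix \<circ> \<beta>) i" by (auto simp: Letters_def deg_of_def col_ix_def)
    qed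
    have "eval_map n f (\<beta>, Inl (2, 2)) = (\<Sum>G\<in>Pow C. (-1) ^ card G * eval_map n (monomial s (w G))
      (\<beta>, Inl (2, 2)))"
      by (simp add: f_def L.sum L.scale sum_apply fun_scale_def)
    also have "\<dots> = (\<Sum>G\<in>Pow C. of_bool ({i \<in> V. deg_of (\<beta> i) = E1} = S) *
       ((-1) ^ card G * of_bool (links V S (swap_pairs \<gamma> G \<circ> \<tau>) (row_ix \<circ> \<beta>) (col_ix \<circ> \<beta>))))"
    proof (intro sum.cong refl)
      fix G assume "G \<in> Pow C"
      then have G: "G \<subseteq> C" by simp
      have comp': "compat (row_ix \<circ> \<beta>) (col_ix \<circ> \<beta>) False (w G) False \<longleftrightarrow>
          links V S (swap_pairs \<gamma> G \<circ> \<tau>) (row_ix \<circ> \<beta>) (col_ix \<circ> \<beta>)"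
        if "{i \<in> V. deg_of (\<beta> i) = E1} = S"
        by (rule comp[OF G row[OF that]])
      have "set (w G) = {1..n}" using w[OF G] V by simp
      note ev = eval_map_monomial[OF \<beta> this n, of s]
      show "(-1) ^ card G * eval_map n (monomial s (w G)) (\<beta>, Inl (2, 2)) =
        of_bool ({i \<in> V. deg_of (\<beta> i) = E1} = S) *
         ((-1) ^ card G * (of_bool (links V S (swap_pairs \<gamma> G \<circ> \<tau>) (row_ix \<circ> \<beta>)
           (col_ix \<circ> \<beta>)) :: 'a))"
        unfolding ev types using comp'
        by (cases "{i \<in> V. deg_of (\<beta> i) = E1} = S") simp_all
    qed
    finally show ?thesis by (simp only: coeff_def sum_distrib_left)
  qed
  ultimately show ?thesis by blast
qed

text \<open>Sources lie in \<open>X\<close> and targets in \<open>V\<close>. They are kept apart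
  because the segments of sources and of targets are shifted against each other when wirings are
  glued.\<close>

definition wirings :: "nat set \<Rightarrow> nat set \<Rightarrow> (nat set \<times> nat set \<times> nat set) set" where
  "wirings X V = {(S, R, C). S \<subseteq> X \<and> (\<exists>\<gamma> \<delta> \<tau>. wiring V S R C \<gamma> \<delta> \<tau>)}"

lemma wirings_memD: "(S, R, C) \<in> wirings X V \<Longrightarrow> S \<subseteq> X \<and> R \<subseteq> S \<and> C \<subseteq> V"
  by (auto simp: wirings_def wiring_def below_match_def)

lemma finite_wirings: "finite X \<Longrightarrow> finite V \<Longrightarrow> finite (wirings X V)"
proof (rule finite_subset)
  show "wirings X V \<subseteq> Pow X \<times> Pow X \<times> Pow V" by (auto dest!: wirings_memD)
qed simp

definition wiring_letters :: "nat \<Rightarrow> nat set \<times> nat set \<times> nat set \<Rightarrow> nat \<Rightarrow> letter" where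
  "wiring_letters n = (\<lambda>(S, R, C) i. if i \<in> {1..n} then
    (if i \<in> S then E1 else E2, i \<in> C, i \<in> R) else undefined)"

text \<open>Each wiring has a polynomial with value 1 at its own letters. At another wiring the
  value can be nonzero only if \<open>\<mu>\<close> is smaller there; hence the evaluation matrix is
  triangular and the images are independent.\<close>

lemma card_wirings_le_graded_codim:
  assumes n: "n \<ge> 1"
  shows "card (wirings {1..n} {1..n}) \<le> graded_codim
    (A_scale :: 'a::field \<Rightarrow> 'a A_alg \<Rightarrow> 'a A_alg) A_mult A_component n"
proof -
  let ?T = "eval_map n :: (T3, 'a) gr_poly \<Rightarrow> _"
    and ?U = "multilinear_polys n :: (T3, 'a) gr_poly set"
  let ?W = "wirings {1..n} {1..n}"
  have fin_W: "finite ?W" by (intro finite_wirings) auto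
  define \<mu> :: "nat set \<times> nat set \<times> nat set \<Rightarrow> nat" where "\<mu> = (\<lambda>(S, R, C). \<Sum>C + \<Sum>(S - R))"
  let ?ev = "\<lambda>f x. ?T f (wiring_letters n x, Inl (2, 2))"
  have "\<exists>f\<in>?U. ?ev f x = 1 \<and> (\<forall>y\<in>?W. ?ev f y \<noteq> 0 \<longrightarrow> y = x \<or> \<mu> y < \<mu> x)"
    if x_mem: "x \<in> ?W" for x
  proof -
    obtain S R C where x: "x = (S, R, C)" by (cases x)
    have S: "S \<subseteq> {1..n}" using x_mem x by (simp add: wirings_def)
    obtain \<gamma> \<delta> \<tau> where wr: "wiring {1..n} S R C \<gamma> \<delta> \<tau>" using x_mem x by (auto simp: wirings_def)
    interpret wired "{1..n}" S R C \<gamma> \<delta> \<tau>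
      using wr S by unfold_locales (auto intro: finite_subset)
    obtain f where f: "f \<in> ?U" and ev: "\<And>\<beta>. \<beta> \<in> letter_maps n \<Longrightarrow> ?T f (\<beta>, Inl (2, 2)) =
       of_bool ({i \<in> {1..n}. deg_of (\<beta> i) = E1} = S) * coeff (row_ix \<circ> \<beta>) (col_ix \<circ> \<beta>)"
      using coeff_realized[OF refl S n, where 'a = 'a] by blast
    have evy: "?ev f (S', R', C') = of_bool (S' = S) * coeff (\<lambda>j. j \<in> C') (\<lambda>i. i \<in> R')"
      if "(S', R', C') \<in> ?W" for S' R' C'
    proof -
      let ?\<beta> = "wiring_letters n (S', R', C')"
      have sub: "S' \<subseteq> {1..n}" "R' \<subseteq> S'" "C' \<subseteq> {1..n}"
        using that by (auto simp: wirings_def wiring_def below_match_def)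
      then have "?\<beta> \<in> letter_maps n"
        by (auto simp: letter_maps_def wiring_letters_def Letters_def)
      moreover have "{i \<in> {1..n}. deg_of (?\<beta> i) = E1} = S'"
        using sub by (auto simp: wiring_letters_def deg_of_def split: if_splits)
      moreover have "(coeff (row_ix \<circ> ?\<beta>) (col_ix \<circ> ?\<beta>) :: 'a) = coeff (\<lambda>j. j \<in> C') (\<lambda>i. i \<in> R')"
        unfolding coeff_def
      proof (intro sum.cong refl arg_cong2[of _ _ _ _ "(*)"] arg_cong[of _ _ of_bool])
        fix G assume "G \<in> Pow C"
        then have G: "G \<subseteq> C" by simp
        have c: "(row_ix \<circ> ?\<beta>) j \<longleftrightarrow> j \<in> C'" "(col_ix \<circ> ?\<beta>) j \<longleftrightarrow> j \<in> R'" if "j \<in> {1..n}" for j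
          using that by (auto simp: wiring_letters_def row_ix_def col_ix_def)
        \<comment> \<open>Only indices in \<open>{1..n}\<close> are inspected, where the letters
          decode to \<open>C'\<close> and \<open>R'\<close>.\<close>
        show "links {1..n} S (swap_pairs \<gamma> G \<circ> \<tau>) (row_ix \<circ> ?\<beta>) (col_ix \<circ> ?\<beta>) =
          links {1..n} S (swap_pairs \<gamma> G \<circ> \<tau>) (\<lambda>j. j \<in> C') (\<lambda>i. i \<in> R')"
          unfolding links_def using S swap_\<tau>(1)[OF G] c by (auto simp: subset_iff)
      qed
      ultimately show ?thesis using ev[of ?\<beta>] by simp
    qed
    have "?ev f x = 1" using evy[of S R C] x_mem x coeff_self[where 'a = 'a] by simp
    moreover have "y = x \<or> \<mu> y < \<mu> x" if y: "y \<in> ?W" "?ev f y \<noteq> 0" for y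
    proof -
      obtain S' R' C' where y': "y = (S', R', C')" by (cases y)
      have S': "S' = S" and nz: "coeff (\<lambda>j. j \<in> C') (\<lambda>i. i \<in> R') \<noteq> (0::'a)"
        using y evy[of S' R' C'] unfolding y' by (auto split: if_splits)
      have sub: "R' \<subseteq> S'" "C' \<subseteq> {1..n}" using y
        by (auto simp: y' wirings_def wiring_def below_match_def)
      have "{j \<in> {1..n}. j \<in> C'} = C'" "{i \<in> S. i \<notin> R'} = S - R'" using sub by auto
      then have "\<Sum>C' + \<Sum>(S - R') < \<Sum>C + \<Sum>(S - R) \<or> C' = C \<and> S - R' = S - R"
        using coeff_nonzero[OF nz] by simp
      moreover have "R' = R" if "S - R' = S - R" using that sub S' RS by blast
      ultimately show ?thesis by (auto simp: \<mu>_def x y' S')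
    qed
    ultimately show ?thesis using f by blast
  qed
  then obtain f where f: "\<And>x. x \<in> ?W \<Longrightarrow> f x \<in> ?U" "\<And>x. x \<in> ?W \<Longrightarrow> ?ev (f x) x = 1"
    "\<And>x y. x \<in> ?W \<Longrightarrow> y \<in> ?W \<Longrightarrow> ?ev (f x) y \<noteq> 0 \<Longrightarrow> y = x \<or> \<mu> y < \<mu> x"
    by metis
  define v where "v = ?T \<circ> f"
  have "\<forall>c. (\<Sum>x\<in>?W. fun_scale (c x) (v x)) = 0 \<longrightarrow> (\<forall>x\<in>?W. c x = 0)"
  proof (intro allI impI, rule ccontr)
    fix c assume 0: "(\<Sum>x\<in>?W. fun_scale (c x) (v x)) = 0" and "\<not> (\<forall>x\<in>?W. c x = 0)"
    then have ne: "{x \<in> ?W. c x \<noteq> 0} \<noteq> {}" and fin: "finite {x \<in> ?W. c x \<noteq> 0}"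
      using fin_W by auto
    \<comment> \<open>Evaluating the relation at a support element \<open>x\<close> of maximal
      \<open>\<mu>\<close> leaves only the term of \<open>x\<close>.\<close>
    obtain x where x: "x \<in> ?W" "c x \<noteq> 0" and max: "\<And>y. y \<in> ?W \<Longrightarrow> c y \<noteq> 0 \<Longrightarrow> \<mu> y \<le> \<mu> x"
    proof -
      have "Max (\<mu> ` {x \<in> ?W. c x \<noteq> 0}) \<in> \<mu> ` {x \<in> ?W. c x \<noteq> 0}"
        using ne fin by (intro Max_in) auto
      then obtain x where "x \<in> ?W" "c x \<noteq> 0" "\<mu> x = Max (\<mu> ` {x \<in> ?W. c x \<noteq> 0})" by auto
      then show thesis using fin by (intro that[of x]) auto
    qed
    have "0 = (\<Sum>y\<in>?W. c y * ?ev (f y) x)"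
      using fun_cong[OF 0, of "(wiring_letters n x, Inl (2, 2))"]
        by (simp add: sum_apply fun_scale_def v_def)
    also have "\<dots> = (\<Sum>y\<in>?W. if y = x then c x else 0)"
    proof (intro sum.cong refl)
      fix y assume y: "y \<in> ?W"
      show "c y * ?ev (f y) x = (if y = x then c x else 0)"
      proof (cases "y = x")
        case False
        then have "c y = 0 \<or> ?ev (f y) x = 0" using f(3)[OF y x(1)] max[OF y] by fastforce
        then show ?thesis using False by auto
      qed (use f(2) x in simp)
    qed
    also have "\<dots> = c x" using x fin_W by (simp add: sum.delta)
    finally show False using x by simp
  qed
  then have v: "inj_on v ?W" "fn.independent (v ` ?W)"
    using fn.independent_family_iff[OF fin_W] by blast+
  obtain G where G: "finite G" "?T ` ?U \<subseteq> fn.span G"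
    by (rule eval_map_span[of n "letter_maps n", where 'a = 'a])
      (auto simp: eval_map_def split: if_splits)
  have "v ` ?W \<subseteq> ?T ` ?U" using f(1) by (auto simp: v_def)
  from fn.maximal_independent_subset_extend[OF this v(2)]
  obtain B where B: "v ` ?W \<subseteq> B" "B \<subseteq> ?T ` ?U" "fn.independent B" "?T ` ?U \<subseteq> fn.span B" by blast
  have "finite B" using fn.independent_span_bound[OF G(1) B(3)] B(2) G(2) by blast
  have "card ?W = card (v ` ?W)" using v(1) by (simp add: card_image)
  also have "\<dots> \<le> card B" using B(1) \<open>finite B\<close> by (rule card_mono[rotated])
  also have "\<dots> = fn.dim (?T ` ?U)" using fn.basis_card_eq_dim[OF B(2,4,3)] .
  finally show ?thesis by (simp add: graded_codim_eq[OF n])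
qed

subsection \<open>Counting wirings\<close>

definition matchable :: "nat set \<Rightarrow> nat \<Rightarrow> nat set set" where
  "matchable V q = {D. card D = q \<and> (\<exists>\<gamma>. below_match \<gamma> D V)}"

lemma matchable_subset: "matchable V q \<subseteq> Pow V"
  by (auto simp: matchable_def below_match_def)

lemma finite_matchable: "finite V \<Longrightarrow> finite (matchable V q)"
  using matchable_subset by (rule finite_subset) simp

lemma empty_matchable: "{} \<in> matchable V 0"
  by (simp add: matchable_def below_match_def)

text \<open>A matched set of size \<open>q\<close> occupies at most \<open>2 * q\<close> points, so
  some point of \<open>V\<close> is free to become the partner of the new maximum
  \<open>b\<close>.\<close>

lemma matchable_insert:
  assumes V: "finite V" "\<And>a. a \<in> V \<Longrightarrow> a < b" and D: "D \<in> matchable V q" and q: "2 * q < card V"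
  shows "insert b D \<in> matchable (insert b V) (Suc q)"
proof -
  obtain \<gamma> where m: "below_match \<gamma> D V" and card: "card D = q" using D by (auto simp: matchable_def)
  have DV: "D \<subseteq> V" "finite D" using m V(1) by (auto simp: below_match_def intro: finite_subset)
  have "card (D \<union> \<gamma> ` D) \<le> card D + card (\<gamma> ` D)" by (rule card_Un_le)
  also have "\<dots> \<le> 2 * q" using card_image_le[OF DV(2), of \<gamma>] card by simp
  finally have "card (D \<union> \<gamma> ` D) < card V" using q by simp
  then obtain x where x: "x \<in> V" "x \<notin> D \<union> \<gamma> ` D"
    by (metis DV(2) card_mono finite_Un finite_imageI not_less subsetI)
  have b: "b \<notin> V" using V(2) by blast
  have "below_match (\<gamma>(b := x)) (insert b D) (insert b V)"
    unfolding below_match_def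
  proof (intro conjI)
    show "inj_on (\<gamma>(b := x)) (insert b D)"
      using m x b DV by (auto simp: below_match_def inj_on_def)
    show "\<forall>c\<in>insert b D. (\<gamma>(b := x)) c < c" using m x V(2) by (auto simp: below_match_def)
    show "(\<gamma>(b := x)) ` insert b D \<subseteq> insert b V - insert b D"
      using m x b DV by (auto simp: below_match_def)
  qed (use DV in auto)
  moreover have "b \<notin> D" using b DV by blast
  ultimately show ?thesis using card DV(2) by (auto simp: matchable_def)
qed

text \<open>The ballot numbers, by Pascal's rule: a matchable set either avoids the maximum
  \<open>b\<close> or arises by inserting it. Allowing \<open>card V + 1\<close> makes the induction
  hypothesis available for \<open>q\<close> itself except in the extreme case.\<close>

lemma card_matchable_ballot:
  assumes "finite V" "2 * q \<le> card V + 1"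
  shows "int (card V choose q) - (if q = 0 then 0 else int (card V choose (q - 1))) \<le>
    int (card (matchable V q))"
  using assms
proof (induction V arbitrary: q rule: finite_linorder_max_induct)
  case empty
  then have "q = 0" by simp
  moreover have "0 < card (matchable {} 0)"
    using empty_matchable finite_matchable[of "{}" 0] by (auto simp: card_gt_0_iff)
  ultimately show ?case by simp
next
  case (insert b V)
  have b: "b \<notin> V" using insert.hyps by blast
  then have cardV: "card (insert b V) = Suc (card V)" using insert.hyps by simp
  show ?case
  proof (cases q)
    case 0
    have "0 < card (matchable (insert b V) 0)"
      using empty_matchable finite_matchable[of "insert b V" 0] insert.hyps
        by (auto simp: card_gt_0_iff)
    then show ?thesis using 0 by simp
  next
    case (Suc k)
    show ?thesis
    proof (cases "2 * Suc k = card V + 2")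
      case True
      \<comment> \<open>Extreme case: the two binomials coincide and the claimed bound is 0.\<close>
      then have "card (insert b V) = 2 * k + 1" using cardV by simp
      moreover have "(2 * k + 1 choose Suc k) = (2 * k + 1 choose k)"
        by (subst binomial_symmetric) auto
      ultimately show ?thesis using Suc by simp
    next
      case False
      then have k: "2 * Suc k \<le> card V + 1" using insert.prems Suc cardV by simp
      have "matchable V (Suc k) \<subseteq> matchable (insert b V) (Suc k)"
        by (auto simp: matchable_def below_match_def)
      moreover have "insert b ` matchable V k \<subseteq> matchable (insert b V) (Suc k)"
        using matchable_insert[OF insert.hyps(1)] insert.hyps(2) k by auto
      ultimately have "card (matchable V (Suc k) \<union> insert b ` matchable V k) \<le>
        card (matchable (insert b V) (Suc k))"
        using insert.hyps by (intro card_mono finite_matchable) auto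
      also have "card (matchable V (Suc k) \<union> insert b ` matchable V k) = card (matchable V
        (Suc k)) + card (insert b ` matchable V k)"
        using matchable_subset b insert.hyps by (intro card_Un_disjoint)
          (auto intro: finite_matchable)
      also have "card (insert b ` matchable V k) = card (matchable V k)"
      proof (rule card_image, rule inj_onI)
        fix D D' assume "D \<in> matchable V k" "D' \<in> matchable V k" "insert b D = insert b D'"
        moreover from this have "b \<notin> D" "b \<notin> D'" using matchable_subset b by blast+
        ultimately show "D = D'" by (metis Diff_insert_absorb)
      qed
      finally have "int (card (matchable V (Suc k))) + int (card (matchable V k)) \<le>
        int (card (matchable (insert b V) (Suc k)))"
        by simp
      moreover have "int (card V choose Suc k) - int (card V choose k) \<le>
        int (card (matchable V (Suc k)))"
        using insert.IH[OF k] by simp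
      moreover have "int (card V choose k) - (if k = 0 then 0 else int (card V choose (k - 1))) \<le>
        int (card (matchable V k))"
        using k by (intro insert.IH) simp
      moreover have "int (Suc (card V) choose k) = int (card V choose k) +
        (if k = 0 then 0 else int (card V choose (k - 1)))"
        by (cases k) auto
      ultimately show ?thesis using Suc cardV by simp
    qed
  qed
qed

lemma Suc_times_binomial_shift: "Suc k * (n choose Suc k) = (n - k) * (n choose k)"
  by (metis binomial_absorb_comp binomial_absorption)

text \<open>With \<open>N = card V\<close>, the ballot number is (N - 2q + 1)/(N - q + 1) times the
  binomial coefficient, and this factor is at least 1/(N + 1).\<close>

lemma card_matchable_ge:
  assumes V: "finite V" and q: "2 * q \<le> card V"
  shows "(card V choose q) \<le> (card V + 1) * card (matchable V q)"
proof (cases q)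
  case 0
  have "0 < card (matchable V 0)"
    using empty_matchable finite_matchable[OF V, of 0] by (auto simp: card_gt_0_iff)
  then show ?thesis using 0 by simp
next
  case (Suc k)
  let ?N = "card V"
  define a where "a = (?N choose q)"
  define b where "b = (?N choose k)"
  have ab: "q * a = (?N - k) * b" using Suc_times_binomial_shift[of k ?N] Suc
    by (simp add: a_def b_def)
  have "int a - int b \<le> int (card (matchable V q))"
    using card_matchable_ballot[OF V, of q] q Suc by (simp add: a_def b_def)
  then have "(int ?N - int k) * (int a - int b) \<le> (int ?N - int k) * int (card (matchable V q))"
    using q Suc by (intro mult_left_mono) auto
  moreover have "(int ?N - int k) * int b = int q * int a"
  proof -
    have "int (?N - k) = int ?N - int k" using q Suc by (simp add: of_nat_diff)
    then show ?thesis using ab by (metis of_nat_mult)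
  qed
  ultimately have "(int ?N - int k - int q) * int a \<le> (int ?N - int k) * int (card (matchable V q))"
    by (simp add: algebra_simps)
  moreover have "1 * int a \<le> (int ?N - int k - int q) * int a"
    using q Suc by (intro mult_right_mono) auto
  moreover have "(int ?N - int k) * int (card (matchable V q)) \<le>
    (int ?N + 1) * int (card (matchable V q))"
    by (intro mult_right_mono) auto
  ultimately have "int a \<le> (int ?N + 1) * int (card (matchable V q))" by linarith
  then have "int a \<le> int ((?N + 1) * card (matchable V q))" by (simp add: algebra_simps)
  then show ?thesis unfolding a_def by (simp only: of_nat_le_iff)
qed

section \<open>Gluing wirings and counting them on segments\<close>

lemma wirings_mono: "X \<subseteq> X' \<Longrightarrow> V \<subseteq> V' \<Longrightarrow> wirings X V \<subseteq> wirings X' V'"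
proof -
  assume XV: "X \<subseteq> X'" "V \<subseteq> V'"
  have "wiring V' S R C \<gamma> \<delta> \<tau>" if "wiring V S R C \<gamma> \<delta> \<tau>" for S R C \<gamma> \<delta> \<tau>
  proof -
    have "below_match \<gamma> C V'" using that XV(2) by (auto simp: wiring_def below_match_def)
    then show ?thesis using that unfolding wiring_def by blast
  qed
  then show ?thesis unfolding wirings_def using XV(1) by fast
qed

lemma below_match_Un:
  assumes "below_match \<gamma>1 C1 V1" "below_match \<gamma>2 C2 V2" "V1 \<inter> V2 = {}"
  shows "below_match (\<lambda>x. if x \<in> V1 then \<gamma>1 x else \<gamma>2 x) (C1 \<union> C2) (V1 \<union> V2)"
proof -
  let ?\<gamma> = "\<lambda>x. if x \<in> V1 then \<gamma>1 x else \<gamma>2 x"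
  have 1: "\<And>c. c \<in> C1 \<Longrightarrow> c \<in> V1 \<and> \<gamma>1 c \<in> V1 \<and> \<gamma>1 c \<notin> C1 \<and> \<gamma>1 c < c" "inj_on \<gamma>1 C1"
    using assms by (auto simp: below_match_def)
  have 2: "\<And>c. c \<in> C2 \<Longrightarrow> c \<in> V2 \<and> c \<notin> V1 \<and> \<gamma>2 c \<in> V2 \<and> \<gamma>2 c \<notin> C2 \<and> \<gamma>2 c < c" "inj_on \<gamma>2 C2"
    using assms by (auto simp: below_match_def)
  have dis: "x \<in> V1 \<Longrightarrow> x \<notin> C2" "x \<in> V2 \<Longrightarrow> x \<notin> C1" "x \<in> V1 \<Longrightarrow> x \<notin> V2" for x using assms(3) 1 2 by blast+
  have "inj_on ?\<gamma> (C1 \<union> C2)"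
  proof (rule inj_onI)
    fix x y assume xy: "x \<in> C1 \<union> C2" "y \<in> C1 \<union> C2" "?\<gamma> x = ?\<gamma> y"
    show "x = y"
    proof (cases "x \<in> V1")
      case True
      then have x: "x \<in> C1" using xy(1) 2(1) by blast
      then have "?\<gamma> y \<in> V1" using xy(3) 1(1) True by metis
      then have "y \<in> C1" using xy(2) 2(1)[of y] dis(3) by (cases "y \<in> C1") auto
      then show ?thesis using x xy(3) 1 by (simp add: inj_on_eq_iff)
    next
      case False
      then have x: "x \<in> C2" using xy(1) 1(1) by blast
      then have "?\<gamma> y \<in> V2" using xy(3) 2(1) False by metis
      then have "y \<in> C2" using xy(2) 1(1)[of y] dis(3) by (cases "y \<in> C2") auto
      then show ?thesis using x xy(3) 2 by (simp add: inj_on_eq_iff)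
    qed
  qed
  moreover have "?\<gamma> c \<in> V1 \<union> V2 - (C1 \<union> C2) \<and> ?\<gamma> c < c" if "c \<in> C1 \<union> C2" for c
    using that 1(1)[of c] 2(1)[of c] dis by (cases "c \<in> C1") auto
  ultimately show ?thesis using 1 2 unfolding below_match_def by blast
qed

text \<open>Sources and targets are glued separately: \<open>V1\<close> may meet \<open>S2\<close>,
  as happens for consecutive segments.\<close>

lemma wiring_Un:
  assumes w1: "wiring V1 S1 R1 C1 \<gamma>1 \<delta>1 \<tau>1" and w2: "wiring V2 S2 R2 C2 \<gamma>2 \<delta>2 \<tau>2"
    and V: "V1 \<inter> V2 = {}" and S: "S1 \<inter> S2 = {}"
  shows "wiring (V1 \<union> V2) (S1 \<union> S2) (R1 \<union> R2) (C1 \<union> C2) (\<lambda>x. if x \<in> V1 then \<gamma>1 x else \<gamma>2 x)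
    (\<lambda>x. if x \<in> S1 then \<delta>1 x else \<delta>2 x) (\<lambda>x. if x \<in> S1 then \<tau>1 x else \<tau>2 x)"
proof -
  have D: "S1 \<union> S2 - (R1 \<union> R2) = (S1 - R1) \<union> (S2 - R2)"
    using w1 w2 S unfolding wiring_def by blast
  have 1: "R1 \<subseteq> S1" "C1 \<subseteq> V1" "bij_betw \<tau>1 R1 C1" "\<And>d. d \<in> S1 - R1 \<Longrightarrow> \<delta>1 d \<in> R1"
    "\<And>r. r \<in> R1 \<Longrightarrow> \<tau>1 r \<in> V1"
    using w1 by (auto simp: wiring_def below_match_def bij_betw_def)
  have 2: "R2 \<subseteq> S2" "C2 \<subseteq> V2" "bij_betw \<tau>2 R2 C2" "\<And>d. d \<in> S2 - R2 \<Longrightarrow> \<delta>2 d \<in> R2"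
    "\<And>r. r \<in> R2 \<Longrightarrow> \<tau>2 r \<in> V2"
    using w2 by (auto simp: wiring_def below_match_def bij_betw_def)
  have 11: "\<And>d. d \<in> S1 - R1 \<Longrightarrow> \<tau>1 d = \<gamma>1 (\<tau>1 (\<delta>1 d))" "\<And>d. d \<in> S1 - R1 \<Longrightarrow> d < \<tau>1 d"
    "\<And>r. r \<in> R1 \<Longrightarrow> r < \<gamma>1 (\<tau>1 r)"
    using w1 unfolding wiring_def by blast+
  have 22: "\<And>d. d \<in> S2 - R2 \<Longrightarrow> \<tau>2 d = \<gamma>2 (\<tau>2 (\<delta>2 d))" "\<And>d. d \<in> S2 - R2 \<Longrightarrow> d < \<tau>2 d"
    "\<And>r. r \<in> R2 \<Longrightarrow> r < \<gamma>2 (\<tau>2 r)"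
    using w2 unfolding wiring_def by blast+
  have nS: "x \<notin> S1" if "x \<in> S2" for x using that S by blast
  have nV: "x \<notin> V1" if "x \<in> V2" for x using that V by blast
  have "bij_betw (\<lambda>x. if x \<in> S1 then \<tau>1 x else \<tau>2 x) (R1 \<union> R2) (C1 \<union> C2)"
  proof (rule bij_betw_combine)
    show "bij_betw (\<lambda>x. if x \<in> S1 then \<tau>1 x else \<tau>2 x) R1 C1"
      using 1(3) by (rule bij_betw_cong[THEN iffD1, rotated]) (use 1 in auto)
    show "bij_betw (\<lambda>x. if x \<in> S1 then \<tau>1 x else \<tau>2 x) R2 C2"
      using 2(3) by (rule bij_betw_cong[THEN iffD1, rotated]) (use 2 nS in auto)
    show "C1 \<inter> C2 = {}" using 1 2 V by blast
  qed
  moreover have "below_match (\<lambda>x. if x \<in> V1 then \<gamma>1 x else \<gamma>2 x) (C1 \<union> C2) (V1 \<union> V2)"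
    using w1 w2 V by (intro below_match_Un) (auto simp: wiring_def)
  moreover have "below_match (\<lambda>x. if x \<in> S1 then \<delta>1 x else \<delta>2 x) (S1 \<union> S2 - (R1 \<union> R2)) (S1 \<union> S2)"
    unfolding D using w1 w2 S by (intro below_match_Un) (auto simp: wiring_def)
  moreover have "\<forall>d\<in>S1 \<union> S2 - (R1 \<union> R2). (if d \<in> S1 then \<tau>1 d else \<tau>2 d) =
     (let e = if d \<in> S1 then \<delta>1 d else \<delta>2 d; f =
       if e \<in> S1 then \<tau>1 e else \<tau>2 e in if f \<in> V1 then \<gamma>1 f else \<gamma>2 f)
     \<and> d < (if d \<in> S1 then \<tau>1 d else \<tau>2 d)"
    unfolding D
  proof
    fix d assume "d \<in> (S1 - R1) \<union> (S2 - R2)"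
    then show "(if d \<in> S1 then \<tau>1 d else \<tau>2 d) =
     (let e = if d \<in> S1 then \<delta>1 d else \<delta>2 d; f =
       if e \<in> S1 then \<tau>1 e else \<tau>2 e in if f \<in> V1 then \<gamma>1 f else \<gamma>2 f)
     \<and> d < (if d \<in> S1 then \<tau>1 d else \<tau>2 d)"
    proof
      assume d: "d \<in> S1 - R1"
      then have "\<delta>1 d \<in> S1" "\<tau>1 (\<delta>1 d) \<in> V1" using 1 by blast+
      then show ?thesis using d 11(1,2)[OF d] by (simp add: Let_def)
    next
      assume d: "d \<in> S2 - R2"
      then have "\<delta>2 d \<notin> S1" "\<tau>2 (\<delta>2 d) \<notin> V1" "d \<notin> S1" using 2 nS nV by blast+
      then show ?thesis using d 22(1,2)[OF d] by (simp add: Let_def)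
    qed
  qed
  moreover have "\<forall>r\<in>R1 \<union> R2. r < (let f = if r \<in> S1 then \<tau>1 r else \<tau>2 r in if f \<in> V1 then \<gamma>1 f
    else \<gamma>2 f)"
  proof
    fix r assume "r \<in> R1 \<union> R2"
    then show "r < (let f = if r \<in> S1 then \<tau>1 r else \<tau>2 r in if f \<in> V1 then \<gamma>1 f else \<gamma>2 f)"
    proof
      assume r: "r \<in> R1"
      then have "r \<in> S1" "\<tau>1 r \<in> V1" using 1 by blast+
      then show ?thesis using r 11(3)[OF r] by (simp add: Let_def)
    next
      assume r: "r \<in> R2"
      then have "r \<notin> S1" "\<tau>2 r \<notin> V1" using 2 nS nV by blast+
      then show ?thesis using r 22(3)[OF r] by (simp add: Let_def)
    qed
  qed
  ultimately show ?thesis using 1(1) 2(1) unfolding wiring_def Let_def by blast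
qed

text \<open>Supermultiplicativity: a union determines its parts by intersection with the disjoint
  blocks.\<close>

lemma card_wirings_Un:
  assumes fin: "finite X1" "finite X2" "finite V1"
    "finite V2" and V: "V1 \<inter> V2 = {}" and X: "X1 \<inter> X2 = {}"
  shows "card (wirings X1 V1) * card (wirings X2 V2) \<le> card (wirings (X1 \<union> X2) (V1 \<union> V2))"
proof -
  let ?u = "\<lambda>((S1, R1, C1), (S2, R2, C2)). (S1 \<union> S2, R1 \<union> R2, C1 \<union> C2)"
  have inj: "inj_on ?u (wirings X1 V1 \<times> wirings X2 V2)"
  proof (rule inj_onI)
    fix x y assume xy: "x \<in> wirings X1 V1 \<times> wirings X2 V2" "y \<in> wirings X1 V1 \<times> wirings X2 V2"
      "?u x = ?u y"
    obtain S1 R1 C1 S2 R2 C2 where x: "x = ((S1, R1, C1), (S2, R2, C2))" by (metis prod.collapse)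
    obtain S1' R1' C1' S2' R2' C2' where y: "y = ((S1', R1', C1'), (S2', R2', C2'))"
      by (metis prod.collapse)
    have mem: "(S1, R1, C1) \<in> wirings X1 V1" "(S2, R2, C2) \<in> wirings X2 V2"
      "(S1', R1', C1') \<in> wirings X1 V1" "(S2', R2', C2') \<in> wirings X2 V2"
      and eq: "S1 \<union> S2 = S1' \<union> S2'" "R1 \<union> R2 = R1' \<union> R2'" "C1 \<union> C2 = C1' \<union> C2'"
      using xy by (simp_all add: x y)
    have split: "A1 = A1' \<and> A2 = A2'"
      if "A1 \<union> A2 = A1' \<union> A2'" "A1 \<subseteq> Y1" "A1' \<subseteq> Y1" "A2 \<subseteq> Y2" "A2' \<subseteq> Y2" "Y1 \<inter> Y2 = {}"
      for A1 A2 A1' A2' Y1 Y2 :: "nat set"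
      using that by blast
    note m = mem[THEN wirings_memD]
    have "S1 = S1' \<and> S2 = S2'" using m by (intro split[OF eq(1) _ _ _ _ X]) auto
    moreover have "R1 = R1' \<and> R2 = R2'" using m by (intro split[OF eq(2) _ _ _ _ X]) auto
    moreover have "C1 = C1' \<and> C2 = C2'" using m by (intro split[OF eq(3) _ _ _ _ V]) auto
    ultimately show "x = y" by (simp add: x y)
  qed
  have "?u ` (wirings X1 V1 \<times> wirings X2 V2) \<subseteq> wirings (X1 \<union> X2) (V1 \<union> V2)"
  proof (safe)
    fix S1 R1 C1 S2 R2 C2
    assume mem: "(S1, R1, C1) \<in> wirings X1 V1" "(S2, R2, C2) \<in> wirings X2 V2"
    then obtain \<gamma>1 \<delta>1 \<tau>1 \<gamma>2 \<delta>2 \<tau>2 where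
      w: "wiring V1 S1 R1 C1 \<gamma>1 \<delta>1 \<tau>1" "wiring V2 S2 R2 C2 \<gamma>2 \<delta>2 \<tau>2"
      by (auto simp: wirings_def)
    have S: "S1 \<subseteq> X1" "S2 \<subseteq> X2" using mem[THEN wirings_memD] by auto
    then have "S1 \<inter> S2 = {}" using X by blast
    from wiring_Un[OF w V this] S
    show "(S1 \<union> S2, R1 \<union> R2, C1 \<union> C2) \<in> wirings (X1 \<union> X2) (V1 \<union> V2)"
      by (auto simp: wirings_def)
  qed
  then have "card (?u ` (wirings X1 V1 \<times> wirings X2 V2)) \<le> card (wirings (X1 \<union> X2) (V1 \<union> V2))"
    using fin by (intro card_mono finite_wirings) auto
  then show ?thesis by (simp add: card_image[OF inj] card_cartesian_product)
qed

text \<open>When \<open>X\<close> lies entirely below \<open>V\<close>, the inequalities of a wiring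
  are automatic. Any bijection from \<open>S - D\<close> to \<open>C\<close> then extends to
  \<open>D\<close> by the formula that the matchings force.\<close>

lemma matchable_wirings:
  assumes fin: "finite X" "finite V" and less: "\<And>x v. x \<in> X \<Longrightarrow> v \<in> V \<Longrightarrow> x < v"
    and S: "S \<subseteq> X" "card S = p + q" and D: "D \<in> matchable S q" and C: "C \<in> matchable V p"
  shows "(S, S - D, C) \<in> wirings X V"
proof -
  obtain \<gamma> \<delta> where \<gamma>: "below_match \<gamma> C V" and \<delta>: "below_match \<delta> D S"
    using C D by (auto simp: matchable_def)
  have sub: "D \<subseteq> S" "C \<subseteq> V" using \<gamma> \<delta> by (auto simp: below_match_def)
  have "finite S" "finite C" using fin S sub by (auto intro: finite_subset)
  moreover have "card (S - D) = card C"
    using S sub C D \<open>finite S\<close> by (auto simp: matchable_def card_Diff_subset finite_subset)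
  ultimately obtain \<tau>0 where \<tau>0: "bij_betw \<tau>0 (S - D) C"
    using finite_same_card_bij[of "S - D" C] by auto
  define \<tau> where "\<tau> i = (if i \<in> D then \<gamma> (\<tau>0 (\<delta> i)) else \<tau>0 i)" for i
  have \<tau>: "bij_betw \<tau> (S - D) C"
    using \<tau>0 by (rule bij_betw_cong[THEN iffD1, rotated]) (auto simp: \<tau>_def)
  have SD: "S - (S - D) = D" using sub by blast
  have \<delta>D: "\<delta> d \<in> S - D" if "d \<in> D" for d using \<delta> that by (auto simp: below_match_def)
  have \<gamma>C: "\<gamma> c \<in> V" if "c \<in> C" for c using \<gamma> that by (auto simp: below_match_def)
  have \<tau>C: "\<tau> r \<in> C" if "r \<in> S - D" for r using \<tau> that by (auto simp: bij_betw_def)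
  have \<tau>D: "\<tau> d = \<gamma> (\<tau> (\<delta> d))" if "d \<in> D" for d using \<delta>D[OF that] that by (simp add: \<tau>_def)
  have "wiring V S (S - D) C \<gamma> \<delta> \<tau>"
    unfolding wiring_def SD
  proof (intro conjI ballI)
    fix d assume d: "d \<in> D"
    show "\<tau> d = \<gamma> (\<tau> (\<delta> d))" by (rule \<tau>D[OF d])
    show "d < \<tau> d" unfolding \<tau>D[OF d] using d S sub \<gamma>C[OF \<tau>C[OF \<delta>D[OF d]]] by (intro less) auto
  next
    fix r assume r: "r \<in> S - D"
    show "r < \<gamma> (\<tau> r)" using r S \<gamma>C[OF \<tau>C[OF r]] by (intro less) auto
  qed (use \<gamma> \<delta> \<tau> in auto)
  then show ?thesis using S by (auto simp: wirings_def)
qed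

text \<open>Choose \<open>S\<close> of size \<open>p + q\<close>, then a matchable \<open>D\<close>
  in \<open>S\<close> and a matchable \<open>C\<close> in \<open>V\<close>. The bounds on
  \<open>p\<close> and \<open>q\<close> make \<open>card_matchable_ge\<close> applicable to both, at
  a cost of \<open>l + 1\<close> each.\<close>

lemma card_segment_wirings:
  assumes fin: "finite X" "finite V" and less: "\<And>x v. x \<in> X \<Longrightarrow> v \<in> V \<Longrightarrow> x < v"
    and l: "card X = l" "card V = l" and pq: "2 * p \<le> l" "q \<le> p" "p + q \<le> l"
  shows "(l choose p) ^ 2 * ((l - p) choose q) \<le> (l + 1) ^ 2 * card (wirings X V)"
proof -
  let ?SS = "{S. S \<subseteq> X \<and> card S = p + q}"
  let ?M = "SIGMA S:?SS. matchable S q \<times> matchable V p"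
  let ?u = "\<lambda>(S, D, C). (S, S - D, C)"
  have finSS: "finite ?SS" and finS: "\<And>S. S \<in> ?SS \<Longrightarrow>
    finite S" using fin by (auto intro: finite_subset)
  have "inj_on ?u ?M"
  proof (rule inj_onI, clarsimp)
    fix S D C D' assume "D \<in> matchable S q" "D' \<in> matchable S q" "S - D = S - D'"
    then show "D = D'" using matchable_subset by blast
  qed
  moreover have "?u ` ?M \<subseteq> wirings X V"
    using matchable_wirings[OF fin less] by auto
  ultimately have "card ?M \<le> card (wirings X V)"
    by (rule card_inj_on_le) (rule finite_wirings[OF fin])
  moreover have "card ?M = (\<Sum>S\<in>?SS. card (matchable S q) * card (matchable V p))"
    unfolding card_cartesian_product[symmetric]
    by (rule card_SigmaI[OF finSS], rule ballI, intro finite_cartesian_product finite_matchable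
      finS fin)
  ultimately have M: "(\<Sum>S\<in>?SS. card (matchable S q) * card (matchable V p)) \<le>
    card (wirings X V)" by simp
  have "(l choose p) ^ 2 * ((l - p) choose q) = (l choose (p + q)) * ((p +
    q choose q) * (l choose p))"
    using choose_mult[of p "p + q" l] pq binomial_symmetric[of q "p + q"]
      by (simp add: power2_eq_square)
  also have "\<dots> = (\<Sum>S\<in>?SS. (p + q choose q) * (l choose p))"
    using n_subsets[OF fin(1), of "p + q"] l by simp
  also have "\<dots> \<le> (\<Sum>S\<in>?SS. ((l + 1) * card (matchable S q)) * ((l + 1) * card (matchable V p)))"
  proof (intro sum_mono mult_mono)
    fix S assume S: "S \<in> ?SS"
    have "(p + q choose q) \<le> (p + q + 1) * card (matchable S q)"
      using card_matchable_ge[OF finS[OF S], of q] S pq by auto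
    also have "\<dots> \<le> (l + 1) * card (matchable S q)" using pq by (intro mult_right_mono) auto
    finally show "(p + q choose q) \<le> (l + 1) * card (matchable S q)" .
    show "(l choose p) \<le> (l + 1) * card (matchable V p)"
      using card_matchable_ge[OF fin(2), of p] l pq by simp
  qed auto
  also have "\<dots> = (l + 1) ^ 2 * (\<Sum>S\<in>?SS. card (matchable S q) * card (matchable V p))"
    by (simp add: sum_distrib_left power2_eq_square algebra_simps)
  also have "\<dots> \<le> (l + 1) ^ 2 * card (wirings X V)" using M by (intro mult_left_mono) auto
  finally show ?thesis .
qed

text \<open>\<open>p\<close> indexes the largest term of the binomial expansion. Comparison with the
  two neighbouring terms places it near l/(1 + sqrt 2), well inside the stated range.\<close>

lemma exists_dominant_term:
  assumes "l \<ge> 5"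
  obtains p where "2 * p \<le> l" "l - p \<le> 2 * p + 1"
    "(1 + sqrt 2) ^ l \<le> real (l + 1) * (real (l choose p) * sqrt 2 ^ (l - p))"
proof -
  define b where "b k = real (l choose k) * sqrt 2 ^ (l - k)" for k
  have "Max (b ` {..l}) \<in> b ` {..l}" by (intro Max_in) auto
  then obtain p where "p \<in> {..l}" and "Max (b ` {..l}) = b p" by (rule imageE)
  then have p: "p \<le> l" and "b p = Max (b ` {..l})" by simp_all
  then have max: "b k \<le> b p" if "k \<le> l" for k using that by simp
  have "(1 + sqrt 2) ^ l = (\<Sum>k\<le>l. b k)"
    using binomial_ring[of 1 "sqrt 2" l] by (simp add: b_def)
  also have "\<dots> \<le> (\<Sum>k\<le>l. b p)" using max by (intro sum_mono) auto
  finally have sum: "(1 + sqrt 2) ^ l \<le> real (l + 1) * b p" by (simp add: ac_simps)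
  have sqrt: "1.4 \<le> sqrt 2" "sqrt 2 \<le> 1.5"
    by (rule real_le_rsqrt, simp add: power2_eq_square)
      (rule real_le_lsqrt, simp_all add: power2_eq_square)
  have shift: "real (Suc k) * real (l choose Suc k) = real (l - k) * real (l choose k)" for k
    using Suc_times_binomial_shift[of k l] by (metis of_nat_mult)
  have low: "2 * p \<le> l"
  proof (cases p)
    case (Suc k)
    have pos: "real (l choose k) > 0" using p Suc by simp
    have e: "l - k = Suc (l - p)" using p Suc by simp
    have "b k \<le> b p" using p Suc by (intro max) simp
    then have "sqrt 2 * real (l choose k) \<le> real (l choose p)"
      unfolding b_def e by (simp add: algebra_simps)
    then have "real p * (sqrt 2 * real (l choose k)) \<le> real p * real (l choose p)"
      by (intro mult_left_mono) auto
    also have "\<dots> = real (l - k) * real (l choose k)" using shift[of k] Suc by simp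
    finally have "real p * sqrt 2 \<le> real (l - k)" using pos by simp
    moreover have "real p * 1.4 \<le> real p * sqrt 2" using sqrt by (intro mult_left_mono) auto
    ultimately show ?thesis using assms p Suc by linarith
  qed simp
  have high: "l - p \<le> 2 * p + 1"
  proof -
    have "p < l" using low assms by simp
    then have e: "l - p = Suc (l - Suc p)" by simp
    have pos: "real (l choose p) > 0" using p by simp
    have "b (Suc p) \<le> b p" using \<open>p < l\<close> by (intro max) simp
    then have "real (l choose Suc p) \<le> sqrt 2 * real (l choose p)"
      unfolding b_def e by (simp add: algebra_simps)
    then have "real (Suc p) * real (l choose Suc p) \<le> real (Suc p) * (sqrt 2 * real (l choose p))"
      by (intro mult_left_mono) auto
    then have "real (l - p) * real (l choose p) \<le> (real (Suc p) * sqrt 2) * real (l choose p)"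
      unfolding shift by (simp only: mult.assoc)
    then have "real (l - p) \<le> real (Suc p) * sqrt 2"
      using pos by (simp only: mult_le_cancel_right_pos)
    also have "\<dots> \<le> real (Suc p) * 1.5" using sqrt by (intro mult_left_mono) auto
    \<comment> \<open>\<open>l \<ge> 5\<close> excludes \<open>p = 0\<close>.\<close>
    finally show ?thesis using assms by (cases p) (auto simp: field_simps)
  qed
  show thesis using that[OF low high] sum by (simp add: b_def)
qed

text \<open>Squaring the dominant term yields \<open>2 ^ (l - p)\<close>, which the central binomial
  coefficient at \<open>q = (l - p) div 2\<close> recovers up to \<open>l + 1\<close>. The fifth
  power collects two factors from the square, one from this coefficient and two from
  \<open>card_segment_wirings\<close>.\<close>

lemma card_segment_wirings_ge:
  assumes "finite X" "finite V" "\<And>x v. x \<in> X \<Longrightarrow> v \<in> V \<Longrightarrow>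
    x < v" "card X = l" "card V = l" and l: "l \<ge> 5"
  shows "(3 + 2 * sqrt 2) ^ l / real (l + 1) ^ 5 \<le> real (card (wirings X V))"
proof -
  obtain p where p: "2 * p \<le> l" "l - p \<le> 2 * p + 1"
    and b: "(1 + sqrt 2) ^ l \<le> real (l + 1) * (real (l choose p) * sqrt 2 ^ (l - p))"
    using exists_dominant_term[OF l] by blast
  define q where "q = (l - p) div 2"
  have q: "q \<le> p" "p + q \<le> l" using p by (auto simp: q_def)
  have "(2::nat) ^ (l - p) = (\<Sum>k\<le>l - p. (l - p) choose k)" by (simp add: choose_row_sum)
  also have "\<dots> \<le> (\<Sum>k\<le>l - p. (l - p) choose q)"
    by (intro sum_mono) (simp add: q_def binomial_maximum)
  also have "\<dots> \<le> (l + 1) * ((l - p) choose q)" by simp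
  finally have two: "(2::nat) ^ (l - p) \<le> (l + 1) * ((l - p) choose q)" .
  have sq: "3 + 2 * sqrt 2 = (1 + sqrt 2)\<^sup>2" by (simp add: power2_eq_square algebra_simps)
  have "(3 + 2 * sqrt 2) ^ l = ((1 + sqrt 2) ^ l) ^ 2"
    unfolding sq power_mult[symmetric] by (simp only: mult.commute)
  also have "\<dots> \<le> (real (l + 1) * (real (l choose p) * sqrt 2 ^ (l - p))) ^ 2"
    using b by (intro power_mono) auto
  also have "\<dots> = real ((l + 1) ^ 2 * ((l choose p) ^ 2 * 2 ^ (l - p)))"
  proof -
    have "(sqrt 2 ^ (l - p))\<^sup>2 = 2 ^ (l - p)"
      by (metis power_even_eq power_mult power2_eq_square real_sqrt_pow2 zero_le_numeral
        mult.commute)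
    then show ?thesis by (simp add: power_mult_distrib)
  qed
  also have "\<dots> \<le> real ((l + 1) ^ 2 * ((l choose p) ^ 2 * ((l + 1) * ((l - p) choose q))))"
    unfolding of_nat_le_iff using two by (intro mult_left_mono) auto
  also have "\<dots> = real ((l + 1) ^ 3 * ((l choose p) ^ 2 * ((l - p) choose q)))"
    by (simp only: power3_eq_cube power2_eq_square mult_ac)
  also have "\<dots> \<le> real ((l + 1) ^ 3 * ((l + 1) ^ 2 * card (wirings X V)))"
    unfolding of_nat_le_iff using card_segment_wirings[OF assms(1-5) p(1) q]
      by (intro mult_left_mono) auto
  also have "\<dots> = real (l + 1) ^ 5 * real (card (wirings X V))"
    by (simp only: of_nat_mult of_nat_power mult.assoc[symmetric] power_add[symmetric]) simp
  finally show ?thesis by (simp add: divide_le_eq mult.commute)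
qed

text \<open>\<open>L + 1\<close> consecutive segments of length \<open>l\<close> carry
  \<open>L\<close> links, each from one segment to the next and each worth a factor
  \<open>g\<close>.\<close>

lemma card_wirings_ge:
  assumes l: "l \<ge> 5" and n: "(L + 1) * l \<le> n"
  shows "((3 + 2 * sqrt 2) ^ l / real (l + 1) ^ 5) ^ L \<le> real (card (wirings {1..n} {1..n}))"
proof -
  define g where "g = (3 + 2 * sqrt 2) ^ l / real (l + 1) ^ 5"
  have g: "g \<ge> 0" by (simp add: g_def)
  have "g ^ L \<le> real (card (wirings {1..L * l} {l + 1..(L + 1) * l}))"
  proof (induction L)
    case 0
    have "({}, {}, {}) \<in> wirings {} {}"
      by (simp add: wirings_def wiring_def below_match_def bij_betw_def)
    then have "card (wirings {} {}) > 0" using finite_wirings[of "{}"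
      "{}"] by (auto simp: card_gt_0_iff)
    then show ?case by simp
  next
    case (Suc L)
    let ?X = "{1..L * l}" and ?V = "{l + 1..(L + 1) * l}"
      and ?X' = "{L * l + 1..(L + 1) * l}" and ?V' = "{(L + 1) * l + 1..(L + 2) * l}"
    have "g \<le> real (card (wirings ?X' ?V'))"
      unfolding g_def by (rule card_segment_wirings_ge) (use l in auto)
    then have "g ^ Suc L \<le> real (card (wirings ?X ?V)) * real (card (wirings ?X' ?V'))"
      using Suc.IH g by (subst power_Suc2) (intro mult_mono; simp)
    also have "\<dots> \<le> real (card (wirings (?X \<union> ?X') (?V \<union> ?V')))"
      unfolding of_nat_mult[symmetric] of_nat_le_iff by (rule card_wirings_Un) auto
    also have "?X \<union> ?X' = {1..Suc L * l}" by auto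
    also have "?V \<union> ?V' = {l + 1..(Suc L + 1) * l}" by auto
    finally show ?case .
  qed
  also have "\<dots> \<le> real (card (wirings {1..n} {1..n}))"
    unfolding of_nat_le_iff using n by (intro card_mono finite_wirings wirings_mono) auto
  finally show ?thesis by (simp add: g_def)
qed

section \<open>Passage to the limit\<close>

theorem theorem5:
  shows "(\<lambda>n. root n (real (graded_codim
            (A_scale :: 'a::field_char_0 \<Rightarrow> 'a A_alg \<Rightarrow> 'a A_alg) A_mult A_component n)))
         \<longlonglongrightarrow> 3 + 2 * sqrt 2"
proof -
  define c where "c n = real (graded_codim (A_scale :: 'a \<Rightarrow> 'a A_alg \<Rightarrow> 'a A_alg) A_mult
    A_component n)" for n
  define x :: real where "x = 3 + 2 * sqrt 2"
  have x: "x > 1" by (simp add: x_def add_pos_nonneg)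
  have "(\<lambda>n. root n (c n)) \<longlonglongrightarrow> x"
  proof (rule order_tendstoI)
    fix a assume a: "x < a"
    have "(\<lambda>n. (6 * sqrt 2) powr (1 / real n) * x) \<longlonglongrightarrow> x" by real_asymp
    from order_tendstoD(2)[OF this a] show "\<forall>\<^sub>F n in sequentially. root n (c n) < a"
      using eventually_gt_at_top[of 0]
    proof eventually_elim
      case (elim n)
      have "c n \<le> 6 * sqrt 2 * x ^ n" unfolding c_def x_def
        using elim by (intro graded_codim_upper) simp
      then have "root n (c n) \<le> root n (6 * sqrt 2 * x ^ n)" using elim by simp
      also have "\<dots> = (6 * sqrt 2) powr (1 / real n) * x"
      proof -
        have "root n (x ^ n) = x" using elim x by (simp add: real_root_power_cancel)
        moreover have "root n (6 * sqrt 2) = (6 * sqrt 2) powr (1 / real n)"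
          using elim by (intro root_powr_inverse) auto
        ultimately show ?thesis by (simp only: real_root_mult[of n "6 * sqrt 2" "x ^ n"])
      qed
      finally show ?case using elim by simp
    qed
  next
    fix a assume a: "a < x"
    \<comment> \<open>A fixed segment length \<open>l\<close> is chosen so that the growth rate per
      variable already exceeds \<open>a\<close>; \<open>g \<ge> 1\<close> is arranged for
      monotonicity in the exponent.\<close>
    have lim: "(\<lambda>l. x / real (l + 1) powr (5 / real l)) \<longlonglongrightarrow> x" by real_asymp
    have "filterlim (\<lambda>l. x ^ l / real (l + 1) ^ 5) at_top sequentially" using x by real_asymp
    then have "\<forall>\<^sub>F l in sequentially. 1 \<le> x ^ l / real (l + 1) ^ 5"
      unfolding filterlim_at_top by blast
    with eventually_ge_at_top[of 5] order_tendstoD(1)[OF lim a]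
    have "\<forall>\<^sub>F l in sequentially. 5 \<le> l \<and> a < x / real (l + 1) powr (5 / real l) \<and>
      1 \<le> x ^ l / real (l + 1) ^ 5"
      by eventually_elim (intro conjI)
    then obtain l where l: "5 \<le> l" "a < x / real (l + 1) powr (5 / real l)"
      "1 \<le> x ^ l / real (l + 1) ^ 5"
      using eventually_happens'[OF sequentially_bot] by blast
    define g where "g = x ^ l / real (l + 1) ^ 5"
    have g: "g \<ge> 1" using l by (simp add: g_def)
    have "g powr (1 / real l) = x / real (l + 1) powr (5 / real l)"
    proof -
      have "g = x powr real l / real (l + 1) powr 5"
        unfolding g_def using x by (simp add: powr_realpow powr_numeral)
      then have "g powr (1 / real l) = (x powr real l) powr (1 / real l) / (real (l +
        1) powr 5) powr (1 / real l)"
        by (simp only: powr_divide)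
      also have "\<dots> = x / real (l + 1) powr (5 / real l)"
        unfolding powr_powr using x l(1) by simp
      finally show ?thesis .
    qed
    then have "a < g powr (1 / real l)" using l by simp
    \<comment> \<open>The term \<open>2 / real n\<close> pays for two lost segments: one by rounding
      \<open>n\<close> to a multiple of \<open>l\<close>, one because the last segment is only a
      target.\<close>
    moreover have "(\<lambda>n. g powr (1 / real l - 2 / real n)) \<longlonglongrightarrow> g powr (1 / real l - 0)"
      by (intro tendsto_powr tendsto_diff tendsto_const lim_const_over_n) (use g in simp)
    ultimately have "\<forall>\<^sub>F n in sequentially. a < g powr (1 / real l - 2 / real n)"
      by (simp add: order_tendstoD(1))
    then show "\<forall>\<^sub>F n in sequentially. a < root n (c n)"
      using eventually_ge_at_top[of l]
    proof eventually_elim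
      case (elim n)
      define L where "L = n div l - 1"
      have n: "n \<ge> 1" using elim l by simp
      have "n div l \<ge> 1" using elim l by (simp add: div_greater_zero_iff Suc_le_eq)
      then have L: "(L + 1) * l \<le> n" by (simp add: L_def)
      have "n < (L + 2) * l" using l dividend_less_div_times[of l n] \<open>n div l \<ge> 1\<close>
        by (simp add: L_def algebra_simps)
      then have "real n \<le> (real L + 2) * real l"
        by (metis less_imp_le of_nat_add of_nat_le_iff of_nat_mult of_nat_numeral)
      then have "real n / real l - 2 \<le> real L" using l by (simp add: field_simps)
      have "(g powr (1 / real l - 2 / real n)) ^ n = g powr (real n / real l - 2)"
      proof -
        have "(1 / real l - 2 / real n) * real n = real n / real l - 2"
          using n by (simp add: left_diff_distrib)
        moreover have "(g powr (1 / real l - 2 / real n)) ^ n = g powr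
          ((1 / real l - 2 / real n) * real n)"
          using g by (simp only: powr_powr[symmetric]) (simp add: powr_realpow)
        ultimately show ?thesis by simp
      qed
      also have "\<dots> \<le> g powr real L" using g \<open>real n / real l - 2 \<le> real L\<close>
        by (rule powr_mono[rotated])
      also have "\<dots> = g ^ L" using g by (simp add: powr_realpow)
      also have "\<dots> \<le> real (card (wirings {1..n} {1..n}))"
        using card_wirings_ge[OF l(1) L] by (simp add: g_def x_def)
      also have "\<dots> \<le> c n" using card_wirings_le_graded_codim[OF n, where 'a = 'a]
        by (simp add: c_def)
      finally have "root n ((g powr (1 / real l - 2 / real n)) ^ n) \<le> root n (c n)" using n by simp
      then show ?case using elim n by (simp add: real_root_power_cancel)
    qed
  qed
  then show ?thesis by (simp add: c_def x_def)
qed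

end
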